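(* Let $(B_n)_{n\in\mathbb{N}}$ be a sequence of closed balls of $\mathbb{R}^d$ satisfying $|B_n|\to0$ and let $\mu$ be a Borel probability measure on $\mathbb{R}^d$. (A) Assume that $(B_n)_{n\in\mathbb{N}}$ is $\mu$-a.c. Then there exists $C>1$ such that for any open ball $B$ with $\mu(B)>0$ there exists a subsequence $(L_{B,n})_{n\in\mathbb{N}}$ of $(B_n)_{n\in\mathbb{N}}$ satisfying $L_{B,n}\subset B$ for every $n\in\mathbb{N}$, $$\sum_{n\ge0}\mu(L_{B,n})=+\infty,$$ and, for infinitely many $Q\in\mathbb{N}$, $$\sum_{s,t=1}^{Q}\mu(L_{B,s}\cap L_{B,t})\le\frac{C}{\mu(B)}\Big(\sum_{n=1}^{Q}\mu(L_{B,n})\Big)^2.$$ (B) Assume that there exists $C>1$ such that for any open ball $B$ with $\mu(B)>0$ there exists a subsequence $(L_{B,n})_{n\in\mathbb{N}}$ of $(B_n)_{n\in\mathbb{N}}$ with $L_{B,n}\subset B$ for every $n\in\mathbb{N}$, with $\sum_{n\ge0}\mu(L_{B,n})=+\infty$, and with $\sum_{s,t=1}^{Q}\mu(L_{B,s}\cap L_{B,t})\le\frac{C}{\mu(B)}\big(\sum_{n=1}^{Q}\mu(L_{B,n})\big)^2$ for infinitely many $Q\in\mathbb{N}$. Then $\mu(\limsup_{n\to+\infty}B_n)=1$, so that, for any $\kappa>1$, $(\kappa B_n)_{n\in\mathbb{N}}$ is $\mu$-a.c.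
   Context: $\mathbb{N}$ includes $0$. Balls are taken in $(\mathbb{R}^d,\|\cdot\|_\infty)$ with positive radius; $B(x,r)$ denotes the closed ball, $|B|$ is the diameter of a ball $B$, and for $t\ge0$, $tB(x,r)=B(x,tr)$. For sets $A_n$, $\limsup_{n\to+\infty}A_n=\bigcap_{g}\bigcup_{n\ge g}A_n$. A sequence of balls $(B_n)_{n\in\mathbb{N}}$ is $\mu$-asymptotically covering ($\mu$-a.c.) if there is a constant $C>0$ such that for every open set $\Omega\subset\mathbb{R}^d$ and every $g\in\mathbb{N}$ there are $N_\Omega\in\mathbb{N}$ (possibly $0$, i.e. the empty family) and integers $g\le n_1\le\dots\le n_{N_\Omega}$ such that: $B_{n_i}\subset\Omega$ for all $1\le i\le N_\Omega$; $B_{n_i}\cap B_{n_j}=\emptyset$ for all $1\le i\ne j\le N_\Omega$; and $\mu\big(\bigcup_{1\le i\le N_\Omega}B_{n_i}\big)\ge C\mu(\Omega)$. *)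

theory Defs
  imports "HOL-Probability.Probability"
begin

text \<open>The metric on \<open>real ^ 'n\<close> in the library is Euclidean, so \<open>ball\<close>, \<open>cball\<close> and \<open>diameter\<close>
  are not the notions attached to the supremum norm. These are built here from \<open>infnorm\<close>.\<close>

definition sup_ball :: "real ^ 'n \<Rightarrow> real \<Rightarrow> (real ^ 'n) set" where
  "sup_ball x r = {y. infnorm (y - x) < r}"

definition sup_cball :: "real ^ 'n \<Rightarrow> real \<Rightarrow> (real ^ 'n) set" where
  "sup_cball x r = {y. infnorm (y - x) \<le> r}"

definition sup_diameter :: "(real ^ 'n) set \<Rightarrow> real" where
  "sup_diameter S = (SUP (y, z) \<in> S \<times> S. infnorm (y - z))"

lemma sup_diameter_sup_cball:
  fixes x :: "real ^ 'n"
  assumes "r \<ge> 0"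
  shows "sup_diameter (sup_cball x r) = 2 * r"
proof -
  have one: "infnorm (One :: real ^ 'n) = 1"
    by (simp add: infnorm_Max)
  show ?thesis
    unfolding sup_diameter_def
  proof (rule cSup_eq_maximum)
    define v :: "real ^ 'n" where "v = r *\<^sub>R One"
    have v: "infnorm v = r" "infnorm (- v) = r" "infnorm (2 *\<^sub>R v) = 2 * r"
      using assms one by (simp_all add: v_def infnorm_mul infnorm_neg)
    have "(x + v, x - v) \<in> sup_cball x r \<times> sup_cball x r"
      using v by (simp add: sup_cball_def)
    moreover have "infnorm ((x + v) - (x - v)) = 2 * r"
      using v by (simp add: scaleR_2)
    ultimately show "2 * r \<in> (\<lambda>(y, z). infnorm (y - z)) ` (sup_cball x r \<times> sup_cball x r)"
      by force
  next
    fix t assume "t \<in> (\<lambda>(y, z). infnorm (y - z)) ` (sup_cball x r \<times> sup_cball x r)"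
    then obtain y z where yz: "infnorm (y - x) \<le> r" "infnorm (z - x) \<le> r" "t = infnorm (y - z)"
      by (auto simp: sup_cball_def)
    have "infnorm ((y - x) + (x - z)) \<le> infnorm (y - x) + infnorm (x - z)"
      by (rule infnorm_triangle)
    then show "t \<le> 2 * r"
      using yz by (simp add: infnorm_sub[of x z])
  qed
qed

text \<open>\<open>N = 0\<close> is allowed; all conditions on the indices are then void and the union is empty.\<close>

definition asymptotically_covering ::
    "(real ^ 'n) measure \<Rightarrow> (nat \<Rightarrow> (real ^ 'n) set) \<Rightarrow> bool" where
  "asymptotically_covering \<mu> B \<longleftrightarrow>
     (\<exists>C>0. \<forall>\<Omega>. open \<Omega> \<longrightarrow> (\<forall>g::nat. \<exists>(N::nat) (n :: nat \<Rightarrow> nat).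
        (\<forall>i\<in>{1..N}. g \<le> n i) \<and>
        (\<forall>i\<in>{1..N}. \<forall>j\<in>{1..N}. i \<le> j \<longrightarrow> n i \<le> n j) \<and>
        (\<forall>i\<in>{1..N}. B (n i) \<subseteq> \<Omega>) \<and>
        (\<forall>i\<in>{1..N}. \<forall>j\<in>{1..N}. i \<noteq> j \<longrightarrow> B (n i) \<inter> B (n j) = {}) \<and>
        measure \<mu> (\<Union>i\<in>{1..N}. B (n i)) \<ge> C * measure \<mu> \<Omega>))"

end

theory Submission
  imports Defs
begin

text \<open>The first part is a counting argument. Applying the covering property of an open ball \<open>U\<close>
  repeatedly gives successive finite families of balls in \<open>U\<close>, each family disjoint and carrying at least the
  proportion \<open>C0\<close> of the mass of \<open>U\<close>. Two families contribute at most the mass of \<open>U\<close> to the sum of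
  the pairwise intersections, so the constant can be taken of order \<open>1 / C0\<^sup>2\<close>
  (\<open>quasi_independent_subsequence\<close>).

  For the second part, the Kochen--Stone lemma (\<open>kochen_stone\<close>) shows that the limsup set \<open>E\<close> of the
  balls fills at least the proportion \<open>1 / C\<close> of each open ball. Open sup-norm balls are the cells of
  cubic grids, and a grid can be shifted so that its walls are null; covering a compact part of the complement
  of \<open>E\<close> by small cells then shows that this complement is null (\<open>full_measure_if_uniform_density\<close>).

  It remains to find, in an open set \<open>\<Omega>\<close>, finitely many disjoint enlarged cubes carrying a fixed
  proportion of its mass. As \<open>E\<close> has full measure, finitely many of the original cubes, with
  enlargements in \<open>\<Omega>\<close>, fill half of \<open>\<Omega>\<close>. The measure is arbitrary and the covered points are not
  the centres of the cubes, so neither the Vitali nor the classical Besicovitch theorem applies;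
  \<open>disjoint_enlarged_subfamily\<close> is a Besicovitch--Morse theorem for this situation. Discarding cubes that lie
  in the enlargement of a larger one leaves a family in which each enlarged cube meets boundedly many enlarged
  cubes of at least its size (\<open>few_larger_neighbours\<close>): seen from a fixed cube, two larger neighbours in
  nearly the same relative position are nearly homothetic with respect to the centre of that cube, and by
  convexity the larger of them contains the smaller in its enlargement. A greedy colouring then splits the
  family into boundedly many disjoint ones, and one of these carries a fixed proportion of the mass.\<close>

section \<open>The supremum norm\<close>

lemma infnorm_le_iff_cart: "infnorm (v :: real ^ 'n) \<le> a \<longleftrightarrow> (\<forall>i. \<bar>v $ i\<bar> \<le> a)"
proof
  show "\<forall>i. \<bar>v $ i\<bar> \<le> a" if "infnorm v \<le> a"
    using component_le_infnorm_cart[of v] that by (meson order_trans)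
  show "infnorm v \<le> a" if "\<forall>i. \<bar>v $ i\<bar> \<le> a"
    using that unfolding infnorm_Max by (auto simp: Basis_vec_def inner_axis)
qed

lemma infnorm_less_iff_cart: "infnorm (v :: real ^ 'n) < a \<longleftrightarrow> (\<forall>i. \<bar>v $ i\<bar> < a)"
proof
  show "\<forall>i. \<bar>v $ i\<bar> < a" if "infnorm v < a"
    using component_le_infnorm_cart[of v] that by (meson le_less_trans)
  show "infnorm v < a" if "\<forall>i. \<bar>v $ i\<bar> < a"
    using that unfolding infnorm_Max by (subst Max_less_iff) (auto simp: Basis_vec_def inner_axis)
qed

lemma infnorm_diff_triangle: "infnorm (a - c) \<le> infnorm (a - b) + infnorm (b - c)"
  for a b c :: "real ^ 'n"
  using infnorm_triangle[of "a - b" "b - c"] by simp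

lemma open_sup_ball: "open (sup_ball c \<rho>)"
  unfolding sup_ball_def by (intro open_Collect_less continuous_intros)

lemma closed_sup_cball: "closed (sup_cball c \<rho>)"
  unfolding sup_cball_def by (intro closed_Collect_le continuous_intros)

lemma sup_cball_subset:
  assumes "infnorm (a - b) + s \<le> t"
  shows "sup_cball a s \<subseteq> sup_cball b t"
proof
  fix y assume "y \<in> sup_cball a s"
  then show "y \<in> sup_cball b t"
    using infnorm_diff_triangle[of y b a] assms by (simp add: sup_cball_def)
qed

section \<open>Disjoint subfamilies of a finite family of enlarged cubes\<close>

text \<open>Run through the cubes in order of decreasing radius and discard each cube that is absorbed by
  one already kept, in the sense that \<open>infnorm (x m - x n) + r m \<le> \<kappa> * r n\<close>, which says that cube
  \<open>m\<close> lies inside the enlargement of cube \<open>n\<close>. The enlargements of the kept cubes cover the original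
  union, and no kept cube absorbs another of at most its radius.\<close>

lemma nonabsorbed_subfamily:
  fixes x :: "'i \<Rightarrow> real ^ 'n" and r :: "'i \<Rightarrow> real"
  assumes "finite F" and \<kappa>: "\<kappa> > 1" and r: "\<And>i. r i > 0"
  obtains S where "S \<subseteq> F"
    and "(\<Union>i\<in>F. sup_cball (x i) (r i)) \<subseteq> (\<Union>i\<in>S. sup_cball (x i) (\<kappa> * r i))"
    and "\<And>m n. m \<in> S \<Longrightarrow> n \<in> S \<Longrightarrow> m \<noteq> n \<Longrightarrow> r m \<le> r n \<Longrightarrow>
           \<not> infnorm (x m - x n) + r m \<le> \<kappa> * r n"
proof -
  have "\<exists>S\<subseteq>F. (\<Union>i\<in>F. sup_cball (x i) (r i)) \<subseteq> (\<Union>i\<in>S. sup_cball (x i) (\<kappa> * r i)) \<and>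
      (\<forall>m\<in>S. \<forall>n\<in>S. m \<noteq> n \<longrightarrow> r m \<le> r n \<longrightarrow> \<not> infnorm (x m - x n) + r m \<le> \<kappa> * r n)"
    using \<open>finite F\<close>
  proof (induction F rule: finite_ranking_induct[where f = "\<lambda>i. - r i"])
    case empty
    then show ?case by auto
  next
    case (insert a F)
    then obtain S where S: "S \<subseteq> F"
      and cov: "(\<Union>i\<in>F. sup_cball (x i) (r i)) \<subseteq> (\<Union>i\<in>S. sup_cball (x i) (\<kappa> * r i))"
      and non: "\<forall>m\<in>S. \<forall>n\<in>S. m \<noteq> n \<longrightarrow> r m \<le> r n \<longrightarrow> \<not> infnorm (x m - x n) + r m \<le> \<kappa> * r n"
      by auto
    show ?case
    proof (cases "\<exists>n\<in>S. infnorm (x a - x n) + r a \<le> \<kappa> * r n")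
      case True
      then obtain n where "n \<in> S" "infnorm (x a - x n) + r a \<le> \<kappa> * r n" by blast
      then have "sup_cball (x a) (r a) \<subseteq> (\<Union>i\<in>S. sup_cball (x i) (\<kappa> * r i))"
        using sup_cball_subset by blast
      then show ?thesis using S cov non by (intro exI[of _ S]) auto
    next
      case False
      have "sup_cball (x a) (r a) \<subseteq> sup_cball (x a) (\<kappa> * r a)"
        using \<kappa> r[of a] by (intro sup_cball_subset) (simp add: infnorm_0)
      moreover have "\<not> infnorm (x m - x n) + r m \<le> \<kappa> * r n"
        if mn: "m \<in> insert a S" "n \<in> insert a S" "m \<noteq> n" "r m \<le> r n" for m n
      proof (cases "n = a")
        case True
        \<comment> \<open>The cube added last is a smallest one, so the two radii agree, and for equal
          radii absorption is symmetric.\<close>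
        then have "m \<in> S" using mn by auto
        then have "r a \<le> r m" using insert.hyps S by force
        then have "r m = r a" using mn True by simp
        then show ?thesis using False \<open>m \<in> S\<close> True by (auto simp: infnorm_sub)
      next
        case n: False
        then show ?thesis using mn non False by auto
      qed
      ultimately show ?thesis using S cov by (intro exI[of _ "insert a S"]) auto
    qed
  qed
  then obtain S where S: "S \<subseteq> F"
    "(\<Union>i\<in>F. sup_cball (x i) (r i)) \<subseteq> (\<Union>i\<in>S. sup_cball (x i) (\<kappa> * r i))"
    "\<forall>m\<in>S. \<forall>n\<in>S. m \<noteq> n \<longrightarrow> r m \<le> r n \<longrightarrow> \<not> infnorm (x m - x n) + r m \<le> \<kappa> * r n"
    by (elim exE conjE)
  from S(3) show ?thesis by (intro that[OF S(1,2)]) simp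
qed

text \<open>One coordinate of an absorption criterion. Two cubes of radii \<open>r1 \<ge> r2\<close> have centres \<open>a\<close> and \<open>b\<close>
  relative to the centre of a third cube of radius \<open>s \<le> r2\<close>, and the enlargement of the first cube meets
  the enlargement of the third. If the relative positions \<open>a / r1\<close> and \<open>b / r2\<close> nearly agree, the second
  cube is nearly the image of the first one under the homothety of ratio \<open>r2 / r1\<close> about the origin. That
  origin nearly lies in the enlargement of the first cube, which by convexity nearly contains its own
  homothetic image. The gain \<open>\<kappa> - 1\<close> absorbs both errors if \<open>s\<close> is small compared with \<open>r2\<close>, or if
  \<open>r1\<close> and \<open>r2\<close> almost agree.\<close>

lemma absorption_coordinate:
  fixes a b r1 r2 s \<kappa> \<epsilon> \<eta> :: real
  assumes \<kappa>: "\<kappa> > 1" and \<epsilon>: "\<epsilon> = (\<kappa> - 1) / 2" and \<eta>: "\<eta> = (\<kappa> - 1) / (2 * \<kappa>)"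
    and s: "s > 0" "s \<le> r2" "r2 \<le> r1"
    and a: "\<bar>a\<bar> \<le> \<kappa> * (r1 + s)"
    and ab: "\<bar>a / r1 - b / r2\<bar> \<le> \<epsilon>"
    and scale: "s \<le> \<eta> * r2 \<or> r1 \<le> r2 + \<eta> * s"
  shows "\<bar>b - a\<bar> + r2 \<le> \<kappa> * r1"
proof -
  have pos: "r1 > 0" "r2 > 0" "\<kappa> > 0" "\<eta> > 0" using s \<kappa> \<eta> by auto
  define t where "t = r2 / r1"
  have t: "0 < t" "t \<le> 1" "r2 = t * r1" using pos s by (auto simp: t_def)
  have "b - a * t = - (a / r1 - b / r2) * r2"
    using pos by (simp add: t_def field_simps)
  then have "\<bar>b - a * t\<bar> = \<bar>a / r1 - b / r2\<bar> * r2"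
    using pos by (simp add: abs_mult)
  then have 1: "\<bar>b - a * t\<bar> \<le> \<epsilon> * r2"
    using ab pos by (simp add: mult_right_mono)
  have "\<bar>b - a\<bar> \<le> \<bar>b - a * t\<bar> + \<bar>a * (1 - t)\<bar>"
    by (simp add: algebra_simps)
  also have "\<bar>a * (1 - t)\<bar> = \<bar>a\<bar> * (1 - t)" using t by (simp add: abs_mult)
  finally have 2: "\<bar>b - a\<bar> \<le> \<epsilon> * r2 + \<kappa> * (r1 + s) * (1 - t)"
    using 1 mult_right_mono[OF a, of "1 - t"] t by linarith
  have 3: "\<kappa> * s * (1 - t) \<le> \<kappa> * \<eta> * r2"
    using scale
  proof
    assume h: "s \<le> \<eta> * r2"
    have "\<kappa> * s * (1 - t) \<le> \<kappa> * s * 1"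
      using t pos s by (intro mult_left_mono) auto
    also have "\<dots> \<le> \<kappa> * (\<eta> * r2)" using h pos by simp
    finally show ?thesis by simp
  next
    assume h: "r1 \<le> r2 + \<eta> * s"
    have "1 - t = (r1 - r2) / r1" using pos by (simp add: t_def field_simps)
    also have "\<dots> \<le> (\<eta> * s) / r1" using h pos by (intro divide_right_mono) auto
    also have "\<dots> \<le> \<eta>" using pos s by (simp add: field_simps)
    finally have "1 - t \<le> \<eta>" .
    then have "s * (1 - t) \<le> r2 * \<eta>" using s t pos by (intro mult_mono) auto
    then have "\<kappa> * (s * (1 - t)) \<le> \<kappa> * (r2 * \<eta>)" using pos by (intro mult_left_mono) auto
    then show ?thesis by (simp add: mult.assoc mult.commute[of r2])
  qed
  have "\<kappa> * \<eta> = (\<kappa> - 1) / 2" using pos \<eta> by simp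
  then have 4: "\<kappa> * s * (1 - t) \<le> (\<kappa> - 1) / 2 * r2" using 3 by metis
  have 5: "\<kappa> * (r1 + s) * (1 - t) = \<kappa> * r1 - \<kappa> * r2 + \<kappa> * s * (1 - t)"
    using t(3) by (simp add: algebra_simps)
  have "\<epsilon> * r2 + (\<kappa> - 1) / 2 * r2 + r2 = \<kappa> * r2" unfolding \<epsilon> by (simp add: field_simps)
  then show ?thesis using 2 4 5 by linarith
qed

lemma floor_eq_imp_close:
  fixes a b :: real
  assumes "\<lfloor>a / e\<rfloor> = \<lfloor>b / e\<rfloor>" "e > 0"
  shows "\<bar>a - b\<bar> \<le> e"
proof -
  have "\<bar>a / e - b / e\<bar> \<le> 1" using assms(1) by linarith
  then have "\<bar>a / e - b / e\<bar> * e \<le> 1 * e" using assms(2) by (intro mult_right_mono) auto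
  moreover have "\<bar>a / e - b / e\<bar> * e = \<bar>(a / e - b / e) * e\<bar>" using assms(2) by (simp add: abs_mult)
  moreover have "(a / e - b / e) * e = a - b" using assms(2) by (simp add: field_simps)
  ultimately show ?thesis by simp
qed

text \<open>A discretization of the cube \<open>m\<close> as seen from the cube \<open>n\<close>: the ratio of the radii, truncated at
  \<open>1 / \<eta> + \<eta>\<close> and rounded to multiples of \<open>\<eta>\<close>, together with the relative position of the centres,
  measured in radii of \<open>m\<close> and rounded coordinatewise to multiples of \<open>\<epsilon>\<close>. Truncation keeps the number of
  types finite; beyond it the cube \<open>n\<close> is so small that the exact ratio is irrelevant.\<close>

definition position_type ::
    "real \<Rightarrow> ('i \<Rightarrow> real ^ 'n) \<Rightarrow> ('i \<Rightarrow> real) \<Rightarrow> 'i \<Rightarrow> 'i \<Rightarrow> int \<times> ('n \<Rightarrow> int)" where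
  "position_type \<kappa> x r n m =
     (let \<epsilon> = (\<kappa> - 1) / 2; \<eta> = (\<kappa> - 1) / (2 * \<kappa>)
      in (\<lfloor>min (1 / \<eta> + \<eta>) (r m / r n) / \<eta>\<rfloor>, \<lambda>i. \<lfloor>((x m - x n) $ i / r m) / \<epsilon>\<rfloor>))"

text \<open>Among cubes none of which absorbs another of at most its radius, the number of those that are at
  least as large as the cube \<open>n\<close> and whose enlargements meet that of \<open>n\<close> is bounded in terms of \<open>\<kappa>\<close> and
  the dimension alone: such neighbours have distinct position types, because of two neighbours of the same
  type the larger would absorb the smaller.\<close>

lemma few_larger_neighbours:
  assumes \<kappa>: "(\<kappa>::real) > 1"
  obtains M :: nat where "\<And>(x :: 'i \<Rightarrow> real ^ 'n) r S n.
    (\<And>i. r i > 0) \<Longrightarrow>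
    (\<And>i j. i \<in> S \<Longrightarrow> j \<in> S \<Longrightarrow> i \<noteq> j \<Longrightarrow> r i \<le> r j \<Longrightarrow>
       \<not> infnorm (x i - x j) + r i \<le> \<kappa> * r j) \<Longrightarrow>
    card {m \<in> S. r n \<le> r m \<and> sup_cball (x m) (\<kappa> * r m) \<inter> sup_cball (x n) (\<kappa> * r n) \<noteq> {}} \<le> M"
proof -
  define \<epsilon> where "\<epsilon> = (\<kappa> - 1) / 2"
  define \<eta> where "\<eta> = (\<kappa> - 1) / (2 * \<kappa>)"
  have pos: "\<epsilon> > 0" "\<eta> > 0" using \<kappa> by (auto simp: \<epsilon>_def \<eta>_def)
  define X where "X = {0..\<lfloor>(1 / \<eta> + \<eta>) / \<eta>\<rfloor>} \<times>
    ((UNIV :: 'n set) \<rightarrow>\<^sub>E {\<lfloor>- 2 * \<kappa> / \<epsilon>\<rfloor>..\<lfloor>2 * \<kappa> / \<epsilon>\<rfloor>})"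
  have finX: "finite X" unfolding X_def by (intro finite_cartesian_product finite_PiE) auto
  show ?thesis
  proof (rule that[of "card X"])
    fix x :: "'i \<Rightarrow> real ^ 'n" and r S n
    assume r: "\<And>i. r i > (0::real)"
      and non: "\<And>i j. i \<in> S \<Longrightarrow> j \<in> S \<Longrightarrow> i \<noteq> j \<Longrightarrow> r i \<le> r j \<Longrightarrow>
        \<not> infnorm (x i - x j) + r i \<le> \<kappa> * r j"
    define N where "N = {m \<in> S. r n \<le> r m \<and>
      sup_cball (x m) (\<kappa> * r m) \<inter> sup_cball (x n) (\<kappa> * r n) \<noteq> {}}"
    define \<tau> where "\<tau> = position_type \<kappa> x r n"
    have \<tau>: "\<tau> m = (\<lfloor>min (1 / \<eta> + \<eta>) (r m / r n) / \<eta>\<rfloor>, \<lambda>i. \<lfloor>((x m - x n) $ i / r m) / \<epsilon>\<rfloor>)" for m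
      by (simp add: \<tau>_def position_type_def Let_def \<epsilon>_def \<eta>_def)
    have near: "\<bar>(x m - x n) $ i\<bar> \<le> \<kappa> * (r m + r n)" if m: "m \<in> N" for m i
    proof -
      obtain y where "y \<in> sup_cball (x m) (\<kappa> * r m)" "y \<in> sup_cball (x n) (\<kappa> * r n)"
        using m unfolding N_def by blast
      then have "infnorm (y - x m) \<le> \<kappa> * r m" "infnorm (y - x n) \<le> \<kappa> * r n"
        by (simp_all add: sup_cball_def)
      then have "infnorm (x m - x n) \<le> \<kappa> * (r m + r n)"
        using infnorm_diff_triangle[of "x m" "x n" y] by (simp add: infnorm_sub[of "x m" y] algebra_simps)
      then show ?thesis using component_le_infnorm_cart order_trans by blast
    qed
    have "\<tau> ` N \<subseteq> X"
    proof
      fix q assume "q \<in> \<tau> ` N"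
      then obtain m where m: "m \<in> N" and q: "q = \<tau> m" by blast
      have le: "r n \<le> r m" using m by (simp add: N_def)
      have "0 \<le> min (1 / \<eta> + \<eta>) (r m / r n) / \<eta>" using pos r by (simp add: less_imp_le)
      moreover have "min (1 / \<eta> + \<eta>) (r m / r n) / \<eta> \<le> (1 / \<eta> + \<eta>) / \<eta>"
        using pos by (intro divide_right_mono) auto
      moreover have "- 2 * \<kappa> / \<epsilon> \<le> ((x m - x n) $ i / r m) / \<epsilon> \<and>
          ((x m - x n) $ i / r m) / \<epsilon> \<le> 2 * \<kappa> / \<epsilon>" for i
      proof -
        have "\<kappa> * (r m + r n) \<le> \<kappa> * (2 * r m)" using le \<kappa> by (intro mult_left_mono) auto
        then have "\<bar>(x m - x n) $ i\<bar> \<le> 2 * \<kappa> * r m" using near[OF m, of i] by simp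
        then have "\<bar>(x m - x n) $ i / r m\<bar> \<le> 2 * \<kappa>" using r[of m] by (simp add: field_simps)
        then have "- (2 * \<kappa>) \<le> (x m - x n) $ i / r m" "(x m - x n) $ i / r m \<le> 2 * \<kappa>"
          by linarith+
        then show ?thesis using pos by (metis divide_right_mono less_imp_le mult_minus_left)
      qed
      ultimately show "q \<in> X" unfolding q \<tau> X_def
        by (auto intro!: floor_mono)
    qed
    moreover have "inj_on \<tau> N"
    proof (rule inj_onI, rule ccontr)
      have *: "\<not> r m2 \<le> r m1" if m: "m1 \<in> N" "m2 \<in> N" "\<tau> m1 = \<tau> m2" "m1 \<noteq> m2" for m1 m2
      proof
        assume le: "r m2 \<le> r m1"
        have n2: "r n \<le> r m2" using m by (simp add: N_def)
        have fl: "\<lfloor>min (1 / \<eta> + \<eta>) (r m1 / r n) / \<eta>\<rfloor> = \<lfloor>min (1 / \<eta> + \<eta>) (r m2 / r n) / \<eta>\<rfloor>"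
          "\<And>i. \<lfloor>((x m1 - x n) $ i / r m1) / \<epsilon>\<rfloor> = \<lfloor>((x m2 - x n) $ i / r m2) / \<epsilon>\<rfloor>"
          using m(3) unfolding \<tau> by (auto simp: fun_eq_iff)
        have close: "\<bar>min (1 / \<eta> + \<eta>) (r m1 / r n) - min (1 / \<eta> + \<eta>) (r m2 / r n)\<bar> \<le> \<eta>"
          using floor_eq_imp_close[OF fl(1)] pos by blast
        \<comment> \<open>Either the smaller ratio also comes within \<open>\<eta>\<close> of the truncation level, or the truncation is
          inactive and the two ratios differ by at most \<open>\<eta>\<close>.\<close>
        have "r n \<le> \<eta> * r m2 \<or> r m1 \<le> r m2 + \<eta> * r n"
        proof (cases "r m1 / r n < 1 / \<eta> + \<eta>")
          case True
          have "r m2 / r n \<le> r m1 / r n" using le r[of n] by (simp add: divide_right_mono)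
          then have "r m1 / r n \<le> r m2 / r n + \<eta>" using close True by linarith
          then show ?thesis using r[of n] by (simp add: field_simps)
        next
          case False
          then have "1 / \<eta> \<le> r m2 / r n" using close by linarith
          then show ?thesis using pos r[of n] by (simp add: field_simps)
        qed
        \<comment> \<open>Hence the larger of the two cubes absorbs the smaller, coordinate by coordinate.\<close>
        then have "\<bar>(x m2 - x n) $ i - (x m1 - x n) $ i\<bar> + r m2 \<le> \<kappa> * r m1" for i
          using absorption_coordinate[OF \<kappa> \<epsilon>_def \<eta>_def r[of n] n2 le near[OF m(1), of i]
            floor_eq_imp_close[OF fl(2)[of i] pos(1)]] by blast
        then have "\<bar>(x m2 - x m1) $ i\<bar> \<le> \<kappa> * r m1 - r m2" for i
          by (simp add: algebra_simps)
        then have "infnorm (x m2 - x m1) + r m2 \<le> \<kappa> * r m1"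
          using infnorm_le_iff_cart[of "x m2 - x m1" "\<kappa> * r m1 - r m2"] by simp
        then show False using non[of m2 m1] m le by (auto simp: N_def)
      qed
      fix m1 m2 assume "m1 \<in> N" "m2 \<in> N" "\<tau> m1 = \<tau> m2" "m1 \<noteq> m2"
      then show False using *[of m1 m2] *[of m2 m1] by force
    qed
    ultimately show "card {m \<in> S. r n \<le> r m \<and>
        sup_cball (x m) (\<kappa> * r m) \<inter> sup_cball (x n) (\<kappa> * r n) \<noteq> {}} \<le> card X"
      unfolding N_def[symmetric] using finX card_inj_on_le by blast
  qed
qed

text \<open>If every vertex of a finite graph has at most \<open>M\<close> neighbours of at least its own rank \<open>r\<close>
  (a possible loop included), then colouring in order of decreasing rank uses at most \<open>M + 1\<close> colours.\<close>

lemma greedy_colouring: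
  fixes R :: "'i \<Rightarrow> 'i \<Rightarrow> bool" and r :: "'i \<Rightarrow> real"
  assumes "finite S" and sym: "\<And>i j. R i j \<Longrightarrow> R j i"
    and deg: "\<And>n. n \<in> S \<Longrightarrow> card {m \<in> S. r n \<le> r m \<and> R m n} \<le> M"
  shows "\<exists>c. (\<forall>i\<in>S. c i \<le> (M::nat)) \<and> (\<forall>i\<in>S. \<forall>j\<in>S. i \<noteq> j \<longrightarrow> R i j \<longrightarrow> c i \<noteq> c j)"
  using \<open>finite S\<close> deg
proof (induction S rule: finite_ranking_induct[where f = "\<lambda>i. - r i"])
  case empty
  then show ?case by simp
next
  case (insert a S)
  have "card {m \<in> S. r n \<le> r m \<and> R m n} \<le> M" if "n \<in> S" for n
  proof -
    have "card {m \<in> S. r n \<le> r m \<and> R m n} \<le> card {m \<in> insert a S. r n \<le> r m \<and> R m n}"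
    proof (rule card_mono)
      show "finite {m \<in> insert a S. r n \<le> r m \<and> R m n}"
        using insert.hyps(1) by (intro finite_Collect_conjI) auto
    qed blast
    also have "\<dots> \<le> M" using that by (intro insert.prems) blast
    finally show ?thesis .
  qed
  then have "\<exists>c. (\<forall>i\<in>S. c i \<le> M) \<and> (\<forall>i\<in>S. \<forall>j\<in>S. i \<noteq> j \<longrightarrow> R i j \<longrightarrow> c i \<noteq> c j)"
    by (rule insert.IH)
  then obtain c
    where c: "\<forall>i\<in>S. c i \<le> M" "\<forall>i\<in>S. \<forall>j\<in>S. i \<noteq> j \<longrightarrow> R i j \<longrightarrow> c i \<noteq> c j"
    by (elim exE conjE)
  define D where "D = {m \<in> S. R m a}"
  have "D \<subseteq> {m \<in> insert a S. r a \<le> r m \<and> R m a}"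
    using insert.hyps(2) by (auto simp: D_def)
  then have "card D \<le> card {m \<in> insert a S. r a \<le> r m \<and> R m a}"
    using insert.hyps(1) by (intro card_mono finite_Collect_conjI) auto
  also have "\<dots> \<le> M" by (intro insert.prems) blast
  finally have "card D \<le> M" .
  then have "card (c ` D) < card {..M}"
    using card_image_le[of D c] insert.hyps(1) by (simp add: D_def)
  then have "\<not> {..M} \<subseteq> c ` D"
    using card_mono[of "c ` D" "{..M}"] insert.hyps(1) by (auto simp: D_def)
  then obtain q where q: "q \<le> M" "q \<notin> c ` D" by auto
  show ?case
  proof (cases "a \<in> S")
    case True
    then show ?thesis using c by (intro exI[of _ c]) (auto simp: insert_absorb)
  next
    case False
    have q': "c m \<noteq> q" if "m \<in> S" "R m a \<or> R a m" for m
      using that q(2) sym[of a m] unfolding D_def by blast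
    show ?thesis
    proof (intro exI[of _ "c(a := q)"] conjI ballI impI)
      fix i assume "i \<in> insert a S"
      then show "(c(a := q)) i \<le> M" using c(1) q(1) by auto
    next
      fix i j assume ij: "i \<in> insert a S" "j \<in> insert a S" "i \<noteq> j" "R i j"
      then consider "i = a" "j \<in> S" "j \<noteq> a" | "j = a" "i \<in> S" "i \<noteq> a"
        | "i \<in> S" "j \<in> S" "i \<noteq> a" "j \<noteq> a" by blast
      then show "(c(a := q)) i \<noteq> (c(a := q)) j"
      proof cases
        case 1
        then show ?thesis using q'[of j] ij(4) by auto
      next
        case 2
        then show ?thesis using q'[of i] ij(4) by auto
      next
        case 3
        then show ?thesis using c(2) ij(3,4) by simp
      qed
    qed
  qed
qed

text \<open>A finite covering theorem of Besicovitch--Morse type. The points to be covered lie in the cubes of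
  radius \<open>r i\<close>, hence well inside the enlarged cubes but possibly far from their centres. The constant
  depends on \<open>\<kappa>\<close> and the dimension only, so \<open>\<mu>\<close> need not be doubling.\<close>

lemma disjoint_enlarged_subfamily:
  assumes \<kappa>: "(\<kappa>::real) > 1"
  obtains M :: nat where "\<And>(x :: 'i \<Rightarrow> real ^ 'n) r F \<mu>.
    (\<And>i. r i > 0) \<Longrightarrow> finite F \<Longrightarrow> finite_measure \<mu> \<Longrightarrow> sets \<mu> = sets borel \<Longrightarrow>
    \<exists>T\<subseteq>F. disjoint_family_on (\<lambda>i. sup_cball (x i) (\<kappa> * r i)) T \<and>
      measure \<mu> (\<Union>i\<in>F. sup_cball (x i) (r i))
        \<le> real (Suc M) * measure \<mu> (\<Union>i\<in>T. sup_cball (x i) (\<kappa> * r i))"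
proof -
  obtain M where M: "\<And>(x :: 'i \<Rightarrow> real ^ 'n) r S n.
    (\<And>i. r i > 0) \<Longrightarrow>
    (\<And>i j. i \<in> S \<Longrightarrow> j \<in> S \<Longrightarrow> i \<noteq> j \<Longrightarrow> r i \<le> r j \<Longrightarrow>
       \<not> infnorm (x i - x j) + r i \<le> \<kappa> * r j) \<Longrightarrow>
    card {m \<in> S. r n \<le> r m \<and> sup_cball (x m) (\<kappa> * r m) \<inter> sup_cball (x n) (\<kappa> * r n) \<noteq> {}} \<le> M"
    by (rule few_larger_neighbours[OF \<kappa>]) (erule that)
  show ?thesis
  proof (rule that[of M])
    fix x :: "'i \<Rightarrow> real ^ 'n" and r :: "'i \<Rightarrow> real" and F :: "'i set" and \<mu> :: "(real ^ 'n) measure"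
    assume r: "\<And>i. r i > 0" and F: "finite F"
      and \<mu>: "finite_measure \<mu>" "sets \<mu> = sets borel"
    interpret finite_measure \<mu> by fact
    let ?H = "\<lambda>i. sup_cball (x i) (\<kappa> * r i)"
    have meas: "?H i \<in> sets \<mu>" for i
      using closed_sup_cball borel_closed \<mu>(2) by blast
    obtain S where S: "S \<subseteq> F"
      and cov: "(\<Union>i\<in>F. sup_cball (x i) (r i)) \<subseteq> (\<Union>i\<in>S. ?H i)"
      and non: "\<And>m n. m \<in> S \<Longrightarrow> n \<in> S \<Longrightarrow> m \<noteq> n \<Longrightarrow> r m \<le> r n \<Longrightarrow>
           \<not> infnorm (x m - x n) + r m \<le> \<kappa> * r n"
      using nonabsorbed_subfamily[where x = x and r = r, OF F \<kappa> r] by blast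
    have finS: "finite S" using S F finite_subset by blast
    have deg: "card {m \<in> S. r n \<le> r m \<and> ?H m \<inter> ?H n \<noteq> {}} \<le> M" for n
      using M[of r S x n, OF r non] .
    obtain c where c: "\<forall>i\<in>S. c i \<le> M"
        "\<forall>i\<in>S. \<forall>j\<in>S. i \<noteq> j \<longrightarrow> ?H i \<inter> ?H j \<noteq> {} \<longrightarrow> c i \<noteq> c j"
      using greedy_colouring[OF finS, of "\<lambda>i j. ?H i \<inter> ?H j \<noteq> {}" r M, OF _ deg]
      by (metis (no_types) inf_commute)
    \<comment> \<open>The enlarged cubes of one colour are disjoint; a colour class of largest measure is taken.\<close>
    define U where "U q = (\<Union>i\<in>{i\<in>S. c i = q}. ?H i)" for q
    have U: "U q \<in> sets \<mu>" for q
      unfolding U_def using finS meas by (intro sets.finite_UN) auto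
    have "(\<Union>i\<in>F. sup_cball (x i) (r i)) \<subseteq> (\<Union>q\<in>{..M}. U q)"
      using cov c(1) by (fastforce simp: U_def)
    then have "measure \<mu> (\<Union>i\<in>F. sup_cball (x i) (r i)) \<le> measure \<mu> (\<Union>q\<in>{..M}. U q)"
      using U by (intro finite_measure_mono sets.finite_UN) auto
    also have "\<dots> \<le> (\<Sum>q\<in>{..M}. measure \<mu> (U q))"
      using U by (intro finite_measure_subadditive_finite) auto
    also have "\<dots> \<le> real (card {..M}) * Max ((\<lambda>q. measure \<mu> (U q)) ` {..M})"
      by (intro sum_bounded_above) auto
    finally have le: "measure \<mu> (\<Union>i\<in>F. sup_cball (x i) (r i)) \<le>
        real (Suc M) * Max ((\<lambda>q. measure \<mu> (U q)) ` {..M})" by simp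
    have "Max ((\<lambda>q. measure \<mu> (U q)) ` {..M}) \<in> (\<lambda>q. measure \<mu> (U q)) ` {..M}"
      by (intro Max_in) auto
    then obtain q where q: "Max ((\<lambda>q. measure \<mu> (U q)) ` {..M}) = measure \<mu> (U q)" by (elim imageE)
    show "\<exists>T\<subseteq>F. disjoint_family_on ?H T \<and> measure \<mu> (\<Union>i\<in>F. sup_cball (x i) (r i))
        \<le> real (Suc M) * measure \<mu> (\<Union>i\<in>T. ?H i)"
    proof (intro exI[of _ "{i\<in>S. c i = q}"] conjI)
      show "{i \<in> S. c i = q} \<subseteq> F" using S by auto
      show "disjoint_family_on ?H {i \<in> S. c i = q}"
        unfolding disjoint_family_on_def using c(2) by blast
      show "measure \<mu> (\<Union>i\<in>F. sup_cball (x i) (r i))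
        \<le> real (Suc M) * measure \<mu> (\<Union>i\<in>{i \<in> S. c i = q}. ?H i)"
        using le q by (simp add: U_def)
    qed
  qed
qed

section \<open>A converse Borel--Cantelli lemma\<close>

text \<open>The Cauchy--Schwarz inequality for the counting function of the \<open>L i\<close> and the indicator of their
  union.\<close>

lemma second_moment_inequality:
  fixes L :: "'i \<Rightarrow> 'a set"
  assumes "finite_measure M" "finite I" and L: "\<And>i. i \<in> I \<Longrightarrow> L i \<in> sets M"
  shows "(\<Sum>i\<in>I. measure M (L i))\<^sup>2 \<le>
    measure M (\<Union>i\<in>I. L i) * (\<Sum>s\<in>I. \<Sum>t\<in>I. measure M (L s \<inter> L t))"
proof -
  interpret finite_measure M by fact
  let ?U = "\<Union>i\<in>I. L i"
  let ?f = "\<lambda>y. \<Sum>i\<in>I. indicator (L i) y :: real"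
  define S where "S = (\<Sum>i\<in>I. measure M (L i))"
  define S2 where "S2 = (\<Sum>s\<in>I. \<Sum>t\<in>I. measure M (L s \<inter> L t))"
  define m where "m = measure M ?U"
  have U: "?U \<in> sets M" using assms by auto
  show ?thesis
  proof (cases "m = 0")
    case True
    have "measure M (L i) \<le> m" if "i \<in> I" for i
      unfolding m_def using that U by (intro finite_measure_mono) auto
    then have "measure M (L i) = 0" if "i \<in> I" for i
      using that True by (simp add: measure_le_0_iff)
    then show ?thesis using True by (simp add: m_def)
  next
    case False
    then have m: "m > 0" by (simp add: m_def zero_less_measure_iff)
    \<comment> \<open>The value of \<open>l\<close> minimizes the integral of the square of \<open>?f - l * indicator ?U\<close>.\<close>
    define l where "l = S / m"
    have expand: "(?f y - l * indicator ?U y)\<^sup>2 =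
        (\<Sum>s\<in>I. \<Sum>t\<in>I. indicator (L s \<inter> L t) y) - 2 * l * ?f y + l\<^sup>2 * indicator ?U y" for y
    proof -
      have sq: "(?f y)\<^sup>2 = (\<Sum>s\<in>I. \<Sum>t\<in>I. indicator (L s \<inter> L t) y)"
        by (simp add: power2_eq_square sum_product indicator_inter_arith)
      have idem: "indicator A y * indicator A y = (indicator A y :: real)" for A
        by (simp add: indicator_def)
      have mul: "?f y * indicator ?U y = ?f y"
        by (cases "y \<in> ?U") (auto intro!: sum.neutral)
      have "(?f y - l * indicator ?U y)\<^sup>2 =
          (?f y)\<^sup>2 - 2 * l * (?f y * indicator ?U y) + l\<^sup>2 * (indicator ?U y * indicator ?U y)"
        by (simp add: power2_eq_square algebra_simps)
      also have "indicator ?U y * indicator ?U y = (indicator ?U y :: real)"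
        by (rule idem)
      finally show ?thesis unfolding sq mul .
    qed
    have int: "integrable M (\<lambda>y. indicator A y :: real)" if "A \<in> sets M" for A
      using that by (intro integrable_real_indicator) (simp_all add: less_top[symmetric])
    have "0 \<le> (LINT y|M. (?f y - l * indicator ?U y)\<^sup>2)"
      by (intro integral_nonneg_AE) simp
    also have "\<dots> = S2 - 2 * l * S + l\<^sup>2 * m"
      unfolding expand S_def S2_def m_def
      using U L by (simp add: int sets.Int Bochner_Integration.integral_sum)
    also have "\<dots> = S2 - S\<^sup>2 / m"
      using m by (simp add: l_def power2_eq_square field_simps)
    finally have "S\<^sup>2 \<le> m * S2" using m by (simp add: field_simps)
    then show ?thesis by (simp add: S_def S2_def m_def)
  qed
qed

text \<open>The Kochen--Stone lemma, for events that are quasi-independent on average along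
  infinitely many partial sums.\<close>

lemma kochen_stone:
  fixes L :: "nat \<Rightarrow> 'a set"
  assumes "prob_space M" and L: "\<And>n. L n \<in> sets M"
    and div: "(\<Sum>n. emeasure M (L n)) = \<infinity>" and D: "D > 0"
    and inf: "infinite {Q. (\<Sum>s=1..Q. \<Sum>t=1..Q. measure M (L s \<inter> L t))
                \<le> D * (\<Sum>n=1..Q. measure M (L n))\<^sup>2}"
  shows "1 / D \<le> measure M (\<Inter>g. \<Union>n\<in>{g..}. L n)"
proof -
  interpret prob_space M by fact
  define A where "A Q = (\<Sum>n=1..Q. measure M (L n))" for Q
  have A_mono: "A P \<le> A Q" if "P \<le> Q" for P Q
    unfolding A_def using that by (intro sum_mono2) auto
  have unbounded: "\<exists>Q. K < A Q" for K
  proof (rule ccontr)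
    assume "\<nexists>Q. K < A Q"
    then have le: "A Q \<le> K" for Q by (meson not_less)
    have "(\<Sum>n<N. measure M (L n)) \<le> 1 + K" for N
    proof -
      have "(\<Sum>n<N. measure M (L n)) \<le> (\<Sum>n\<in>insert 0 {1..N}. measure M (L n))"
        by (intro sum_mono2) auto
      also have "\<dots> \<le> 1 + K" using le[of N] by (simp add: A_def add_mono)
      finally show ?thesis .
    qed
    then have "summable (\<lambda>n. measure M (L n))"
      by (intro summableI_nonneg_bounded) auto
    then have "(\<Sum>n. ennreal (measure M (L n))) \<noteq> top"
      by (intro ennreal_suminf_neq_top) auto
    then show False using div unfolding emeasure_eq_measure infinity_ennreal_def by contradiction
  qed
  have tail: "1 / D \<le> measure M (\<Union>n\<in>{g..}. L n)" for g
  proof (rule ccontr)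
    define v where "v = measure M (\<Union>n\<in>{g..}. L n)"
    assume "\<not> 1 / D \<le> measure M (\<Union>n\<in>{g..}. L n)"
    then have vD: "0 \<le> v * D" "v * D < 1" using D by (auto simp: v_def field_simps)
    \<comment> \<open>The second moment inequality on the tail gives \<open>A Q - g \<le> w * A Q\<close> for arbitrarily large \<open>A Q\<close>,
      although \<open>w < 1\<close>.\<close>
    define w where "w = sqrt (v * D)"
    have w: "0 \<le> w" "w < 1" "w\<^sup>2 = v * D" using vD by (auto simp: w_def)
    obtain P where P: "real g / (1 - w) < A P" using unbounded by blast
    obtain Q where Q: "Q \<ge> P" "(\<Sum>s=1..Q. \<Sum>t=1..Q. measure M (L s \<inter> L t)) \<le> D * (A Q)\<^sup>2"
      using inf unfolding infinite_nat_iff_unbounded_le A_def by blast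
    let ?I = "{max 1 g..Q}"
    have "A Q \<le> (\<Sum>n\<in>{..<g} \<union> ?I. measure M (L n))"
      unfolding A_def by (intro sum_mono2) auto
    also have "\<dots> \<le> (\<Sum>n<g. measure M (L n)) + (\<Sum>n\<in>?I. measure M (L n))"
      by (subst sum.union_inter[symmetric]) (auto intro!: sum_nonneg)
    also have "(\<Sum>n<g. measure M (L n)) \<le> real g"
      using sum_mono[of "{..<g}" "\<lambda>n. measure M (L n)" "\<lambda>_. 1"] by simp
    finally have "A Q - g \<le> (\<Sum>n\<in>?I. measure M (L n))" by simp
    moreover have "(\<Sum>n\<in>?I. measure M (L n)) \<le> w * A Q"
    proof -
      have "(\<Sum>n\<in>?I. measure M (L n))\<^sup>2 \<le>
          measure M (\<Union>n\<in>?I. L n) * (\<Sum>s\<in>?I. \<Sum>t\<in>?I. measure M (L s \<inter> L t))"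
        by (intro second_moment_inequality L) (auto intro: finite_measure_axioms)
      also have "\<dots> \<le> v * (D * (A Q)\<^sup>2)"
      proof (rule mult_mono)
        show "measure M (\<Union>n\<in>?I. L n) \<le> v"
          unfolding v_def using L by (intro finite_measure_mono sets.countable_UN) auto
        have "(\<Sum>s\<in>?I. \<Sum>t\<in>?I. measure M (L s \<inter> L t)) \<le> (\<Sum>s=1..Q. \<Sum>t\<in>?I. measure M (L s \<inter> L t))"
          by (intro sum_mono2 sum_nonneg) auto
        also have "\<dots> \<le> (\<Sum>s=1..Q. \<Sum>t=1..Q. measure M (L s \<inter> L t))"
          by (intro sum_mono sum_mono2) auto
        finally show "(\<Sum>s\<in>?I. \<Sum>t\<in>?I. measure M (L s \<inter> L t)) \<le> D * (A Q)\<^sup>2"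
          using Q(2) by linarith
      qed (auto simp: v_def intro!: sum_nonneg)
      also have "\<dots> = (w * A Q)\<^sup>2" using w(3) by (simp add: power_mult_distrib)
      finally show ?thesis
        by (rule power2_le_imp_le) (use w(1) in \<open>auto simp: A_def intro!: mult_nonneg_nonneg sum_nonneg\<close>)
    qed
    ultimately have "A Q * (1 - w) \<le> g" by (simp add: algebra_simps)
    then have "A Q \<le> real g / (1 - w)" using w(2) by (simp add: field_simps)
    then show False using P A_mono[OF Q(1)] by linarith
  qed
  have "(\<lambda>g. measure M (\<Union>n\<in>{g..}. L n)) \<longlonglongrightarrow> measure M (\<Inter>g. \<Union>n\<in>{g..}. L n)"
  proof (rule finite_Lim_measure_decseq)
    show "range (\<lambda>g. \<Union>n\<in>{g..}. L n) \<subseteq> sets M" using L by blast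
    show "decseq (\<lambda>g. \<Union>n\<in>{g..}. L n)"
      unfolding decseq_def by (intro allI impI UN_mono) auto
  qed
  then show ?thesis using tail LIMSEQ_le_const by blast
qed

section \<open>Grids with null walls\<close>

text \<open>Only countably many hyperplanes orthogonal to a coordinate axis have positive measure, so a single
  offset \<open>t\<close> avoids them in all directions at once.\<close>

lemma null_grid_walls:
  fixes \<mu> :: "(real ^ 'n) measure"
  assumes "finite_measure \<mu>" and sets: "sets \<mu> = sets borel"
  obtains t :: real where "\<And>i (k::int). measure \<mu> {y. y $ i = t + \<delta> * of_int k} = 0"
proof -
  interpret finite_measure \<mu> by fact
  have space: "space \<mu> = UNIV" using sets_eq_imp_space_eq[OF sets] by simp
  have meas: "(\<lambda>y. y $ i) \<in> \<mu> \<rightarrow>\<^sub>M borel" for i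
    unfolding measurable_cong_sets[OF sets refl]
    by (intro borel_measurable_continuous_onI continuous_intros)
  define H where "H i = {a. measure \<mu> {y. y $ i = a} \<noteq> 0}" for i :: 'n
  have "countable (H i)" for i
  proof -
    interpret D: finite_measure "distr \<mu> borel (\<lambda>y. y $ i)"
      using meas by (rule finite_measure_distr)
    have "measure (distr \<mu> borel (\<lambda>y. y $ i)) {a} = measure \<mu> {y. y $ i = a}" for a
      using meas by (subst measure_distr) (auto simp: space vimage_def)
    then show ?thesis using D.countable_support by (simp add: H_def)
  qed
  then have "countable (\<Union>i. \<Union>k::int. (\<lambda>a. a - \<delta> * of_int k) ` H i)" by auto
  then obtain t where t: "t \<notin> (\<Union>i. \<Union>k::int. (\<lambda>a. a - \<delta> * of_int k) ` H i)"
    using uncountable_UNIV_real by (metis UNIV_eq_I)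
  show ?thesis
  proof (rule that[of t], rule ccontr)
    fix i k assume "measure \<mu> {y. y $ i = t + \<delta> * of_int k} \<noteq> 0"
    then have "t + \<delta> * of_int k \<in> H i" by (simp add: H_def)
    then have "t \<in> (\<lambda>a. a - \<delta> * of_int k) ` H i" by (intro image_eqI) auto
    then show False using t by blast
  qed
qed

text \<open>The cells of the cubic grid with offset \<open>t\<close> and mesh \<open>\<delta>\<close> are indexed by \<open>'n \<Rightarrow> int\<close>, a countable
  type; the open cell \<open>j\<close> is the open sup-norm ball of radius \<open>\<delta> / 2\<close> about the point below.\<close>

definition grid_centre :: "real \<Rightarrow> real \<Rightarrow> ('n \<Rightarrow> int) \<Rightarrow> real ^ 'n" where
  "grid_centre t \<delta> j = (\<chi> i. t + \<delta> * (of_int (j i) + 1 / 2))"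

lemma mem_grid_cell_iff:
  assumes "\<delta> > 0"
  shows "y \<in> sup_ball (grid_centre t \<delta> j) (\<delta> / 2) \<longleftrightarrow>
    (\<forall>i. t + \<delta> * of_int (j i) < y $ i \<and> y $ i < t + \<delta> * (of_int (j i) + 1))"
proof -
  have "\<bar>(y - grid_centre t \<delta> j) $ i\<bar> < \<delta> / 2 \<longleftrightarrow>
      t + \<delta> * of_int (j i) < y $ i \<and> y $ i < t + \<delta> * (of_int (j i) + 1)" for i
    unfolding grid_centre_def vector_minus_component vec_lambda_beta distrib_left by linarith
  then show ?thesis unfolding sup_ball_def mem_Collect_eq infnorm_less_iff_cart by presburger
qed

lemma disjoint_grid_cells:
  assumes "\<delta> > 0"
  shows "disjoint_family_on (\<lambda>j. sup_ball (grid_centre t \<delta> j) (\<delta> / 2)) J"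
  unfolding disjoint_family_on_def
proof (intro ballI impI, rule ccontr)
  fix j k :: "'a \<Rightarrow> int"
  assume "j \<noteq> k" and "sup_ball (grid_centre t \<delta> j) (\<delta> / 2) \<inter> sup_ball (grid_centre t \<delta> k) (\<delta> / 2) \<noteq> {}"
  then obtain y where y: "y \<in> sup_ball (grid_centre t \<delta> j) (\<delta> / 2)"
    "y \<in> sup_ball (grid_centre t \<delta> k) (\<delta> / 2)" by blast
  have "j i = k i" for i
  proof -
    have "t + \<delta> * of_int (j i) < t + \<delta> * (of_int (k i) + 1)"
      "t + \<delta> * of_int (k i) < t + \<delta> * (of_int (j i) + 1)"
      using y unfolding mem_grid_cell_iff[OF assms] by (meson less_trans)+
    then have "real_of_int (j i) < of_int (k i) + 1" "real_of_int (k i) < of_int (j i) + 1"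
      using assms by auto
    then show ?thesis by linarith
  qed
  then show False using \<open>j \<noteq> k\<close> by blast
qed

lemma mem_grid_cell_or_wall:
  assumes "\<delta> > 0"
  shows "(\<exists>j. y \<in> sup_ball (grid_centre t \<delta> j) (\<delta> / 2)) \<or> (\<exists>i (k::int). y $ i = t + \<delta> * of_int k)"
proof (cases "\<exists>i (k::int). y $ i = t + \<delta> * of_int k")
  case False
  define j where "j i = \<lfloor>(y $ i - t) / \<delta>\<rfloor>" for i
  have "t + \<delta> * of_int (j i) < y $ i \<and> y $ i < t + \<delta> * (of_int (j i) + 1)" for i
  proof -
    have "of_int (j i) \<le> (y $ i - t) / \<delta>" "(y $ i - t) / \<delta> < of_int (j i) + 1"
      by (auto simp: j_def)
    then have "t + \<delta> * of_int (j i) \<le> y $ i" "y $ i < t + \<delta> * (of_int (j i) + 1)"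
      using assms by (auto simp: field_simps)
    moreover have "y $ i \<noteq> t + \<delta> * of_int (j i)" using False by blast
    ultimately show ?thesis by simp
  qed
  then show ?thesis unfolding mem_grid_cell_iff[OF assms] by blast
qed blast

text \<open>A grid of small mesh with null walls replaces a density theorem for \<open>\<mu>\<close>. If the complement of
  \<open>E\<close> had positive measure, it would contain a compact set \<open>K\<close> of positive measure; take an open \<open>U\<close>
  around \<open>K\<close> of almost the same measure. The grid cells that meet \<open>K\<close> are disjoint balls inside \<open>U\<close>
  covering almost all of \<open>K\<close>, and each of them loses at least the proportion \<open>1 / D\<close> of its
  measure to \<open>E\<close>, so \<open>K\<close> would have too little measure.\<close>

lemma full_measure_if_uniform_density:
  fixes \<mu> :: "(real ^ 'n) measure"
  assumes "prob_space \<mu>" and sets: "sets \<mu> = sets borel" and E: "E \<in> sets borel" and D: "D > 1"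
    and dens: "\<And>c \<rho>. \<rho> > 0 \<Longrightarrow> measure \<mu> (sup_ball c \<rho>) / D \<le> measure \<mu> (sup_ball c \<rho> \<inter> E)"
  shows "measure \<mu> E = 1"
proof (rule ccontr)
  interpret prob_space \<mu> by fact
  have space: "space \<mu> = UNIV" using sets_eq_imp_space_eq[OF sets] by simp
  have E': "E \<in> sets \<mu>" "- E \<in> sets \<mu>" using E sets by (auto simp: borel_comp)
  have open_sets: "U \<in> sets \<mu>" if "open U" for U using that sets by auto
  define \<theta> where "\<theta> = 1 - 1 / D"
  have \<theta>: "0 < \<theta>" "\<theta> < 1" using D by (auto simp: \<theta>_def)
  assume "measure \<mu> E \<noteq> 1"
  then have "measure \<mu> (- E) \<noteq> 0"
    using prob_compl[OF E'(1)] by (simp add: space Compl_eq_Diff_UNIV)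
  then have "0 < emeasure \<mu> (- E)" by (simp add: emeasure_eq_measure zero_less_measure_iff)
  also have "emeasure \<mu> (- E) = (SUP K \<in> {K. K \<subseteq> - E \<and> compact K}. emeasure \<mu> K)"
    using E by (intro inner_regular sets) (auto simp: borel_comp)
  finally obtain K where K: "K \<subseteq> - E" "compact K" "0 < emeasure \<mu> K"
    by (auto simp: less_SUP_iff)
  have Km: "K \<in> sets \<mu>" using K(2) sets by (simp add: borel_compact)
  have Kpos: "0 < measure \<mu> K" using K(3) by (simp add: emeasure_eq_measure)
  have "emeasure \<mu> K < ennreal (measure \<mu> K / \<theta>)"
    using \<theta> Kpos by (simp add: emeasure_eq_measure ennreal_less_iff field_simps)
  moreover have "emeasure \<mu> K = (INF U \<in> {U. K \<subseteq> U \<and> open U}. emeasure \<mu> U)"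
    using Km sets by (intro outer_regular) auto
  ultimately obtain U where U: "K \<subseteq> U" "open U" "emeasure \<mu> U < ennreal (measure \<mu> K / \<theta>)"
    by (auto simp: INF_less_iff)
  have U\<theta>: "\<theta> * measure \<mu> U < measure \<mu> K"
    using U(3) \<theta> Kpos by (simp add: emeasure_eq_measure ennreal_less_iff field_simps)
  obtain e where e: "e > 0" "(\<Union>y\<in>K. ball y e) \<subseteq> U"
    using compact_subset_open_imp_ball_epsilon_subset[OF K(2) U(2,1)] by blast
  define \<delta> where "\<delta> = e / sqrt (real CARD('n))"
  have \<delta>: "\<delta> > 0" using e by (simp add: \<delta>_def)
  obtain t where t: "\<And>i (k::int). measure \<mu> {y. y $ i = t + \<delta> * of_int k} = 0"
    using null_grid_walls[OF finite_measure_axioms sets] by blast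
  define Q where "Q j = sup_ball (grid_centre t \<delta> j :: real ^ 'n) (\<delta> / 2)" for j
  define J where "J = {j. Q j \<inter> K \<noteq> {}}"
  have Q: "Q j \<in> sets \<mu>" for j unfolding Q_def by (intro open_sets open_sup_ball)
  have disj: "disjoint_family_on Q J" unfolding Q_def by (rule disjoint_grid_cells[OF \<delta>])
  have disj': "disjoint_family_on (\<lambda>j. Q j - E) J"
    using disj by (auto simp: disjoint_family_on_def)
  have QU: "Q j \<subseteq> U" if j: "j \<in> J" for j
  proof
    fix z assume z: "z \<in> Q j"
    obtain y where y: "y \<in> Q j" "y \<in> K" using j by (auto simp: J_def)
    have "infnorm (y - z) < \<delta>"
      using y(1) z infnorm_diff_triangle[of y z "grid_centre t \<delta> j"]
      by (simp add: Q_def sup_ball_def infnorm_sub[of "grid_centre t \<delta> j" z])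
    then have "sqrt (real CARD('n)) * infnorm (y - z) < e"
      by (simp add: \<delta>_def field_simps)
    then have "dist y z < e"
      using norm_le_infnorm[of "y - z"] by (simp add: dist_norm)
    then have "z \<in> ball y e" by simp
    then show "z \<in> U" using e(2) y(2) by blast
  qed
  define W where "W = (\<Union>i. \<Union>k::int. {y :: real ^ 'n. y $ i = t + \<delta> * of_int k})"
  have wall: "{y :: real ^ 'n. y $ i = a} \<in> sets \<mu>" for i a
    using sets by (auto intro!: borel_closed closed_Collect_eq continuous_intros)
  have "W \<in> null_sets \<mu>"
    unfolding W_def using wall t
    by (intro null_sets_UN null_setsI) (auto simp: emeasure_eq_measure)
  then have Kle: "emeasure \<mu> K = emeasure \<mu> (K - W)" using emeasure_Diff_null_set Km by metis
  have "K - W \<subseteq> (\<Union>j\<in>J. Q j - E)"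
  proof
    fix y assume y: "y \<in> K - W"
    then obtain j where "y \<in> Q j"
      using mem_grid_cell_or_wall[OF \<delta>, of y t] by (auto simp: W_def Q_def)
    then show "y \<in> (\<Union>j\<in>J. Q j - E)" using y K(1) by (auto simp: J_def)
  qed
  then have "emeasure \<mu> (K - W) \<le> emeasure \<mu> (\<Union>j\<in>J. Q j - E)"
    using Q E' by (intro emeasure_mono sets.countable_UN') auto
  also have "\<dots> = (\<integral>\<^sup>+j. emeasure \<mu> (Q j - E) \<partial>count_space J)"
    using Q E' disj' by (intro emeasure_UN_countable) auto
  also have "\<dots> \<le> (\<integral>\<^sup>+j. ennreal \<theta> * emeasure \<mu> (Q j) \<partial>count_space J)"
  proof (rule nn_integral_mono)
    fix j
    have "measure \<mu> (Q j - E) = measure \<mu> (Q j) - measure \<mu> (Q j \<inter> E)"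
      using Q E' by (intro finite_measure_Diff') auto
    also have "\<dots> \<le> \<theta> * measure \<mu> (Q j)"
      using dens[of "\<delta> / 2" "grid_centre t \<delta> j"] \<delta> by (simp add: \<theta>_def Q_def algebra_simps)
    finally show "emeasure \<mu> (Q j - E) \<le> ennreal \<theta> * emeasure \<mu> (Q j)"
      using \<theta> by (simp add: emeasure_eq_measure ennreal_mult''[symmetric])
  qed
  also have "\<dots> = ennreal \<theta> * (\<integral>\<^sup>+j. emeasure \<mu> (Q j) \<partial>count_space J)"
    by (intro nn_integral_cmult) auto
  also have "(\<integral>\<^sup>+j. emeasure \<mu> (Q j) \<partial>count_space J) = emeasure \<mu> (\<Union>j\<in>J. Q j)"
    using Q disj by (intro emeasure_UN_countable[symmetric]) auto
  also have "ennreal \<theta> * emeasure \<mu> (\<Union>j\<in>J. Q j) \<le> ennreal \<theta> * emeasure \<mu> U"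
    using QU U(2) by (intro mult_left_mono emeasure_mono open_sets) auto
  finally have "measure \<mu> K \<le> \<theta> * measure \<mu> U"
    using \<theta> Kle by (simp add: emeasure_eq_measure ennreal_mult''[symmetric])
  then show False using U\<theta> by linarith
qed

section \<open>Asymptotically covering sequences\<close>

text \<open>The families in the definition may be given as finite sets of indices.\<close>

lemma asymptotically_covering_iff:
  "asymptotically_covering \<mu> B \<longleftrightarrow>
     (\<exists>C>0. \<forall>\<Omega>. open \<Omega> \<longrightarrow> (\<forall>g. \<exists>T. finite T \<and> T \<subseteq> {g..} \<and> (\<forall>i\<in>T. B i \<subseteq> \<Omega>) \<and>
        disjoint_family_on B T \<and> C * measure \<mu> \<Omega> \<le> measure \<mu> (\<Union>i\<in>T. B i)))"
proof -
  have "(\<exists>(N::nat) (n :: nat \<Rightarrow> nat).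
        (\<forall>i\<in>{1..N}. g \<le> n i) \<and>
        (\<forall>i\<in>{1..N}. \<forall>j\<in>{1..N}. i \<le> j \<longrightarrow> n i \<le> n j) \<and>
        (\<forall>i\<in>{1..N}. B (n i) \<subseteq> \<Omega>) \<and>
        (\<forall>i\<in>{1..N}. \<forall>j\<in>{1..N}. i \<noteq> j \<longrightarrow> B (n i) \<inter> B (n j) = {}) \<and>
        measure \<mu> (\<Union>i\<in>{1..N}. B (n i)) \<ge> C * measure \<mu> \<Omega>) \<longleftrightarrow>
      (\<exists>T. finite T \<and> T \<subseteq> {g..} \<and> (\<forall>i\<in>T. B i \<subseteq> \<Omega>) \<and>
        disjoint_family_on B T \<and> C * measure \<mu> \<Omega> \<le> measure \<mu> (\<Union>i\<in>T. B i))"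
    (is "?L \<longleftrightarrow> ?R") for C \<Omega> g
  proof
    assume ?L
    then obtain N :: nat and n :: "nat \<Rightarrow> nat" where
      n: "\<forall>i\<in>{1..N}. g \<le> n i" "\<forall>i\<in>{1..N}. B (n i) \<subseteq> \<Omega>"
        "\<forall>i\<in>{1..N}. \<forall>j\<in>{1..N}. i \<noteq> j \<longrightarrow> B (n i) \<inter> B (n j) = {}"
        "C * measure \<mu> \<Omega> \<le> measure \<mu> (\<Union>i\<in>{1..N}. B (n i))"
      by (elim exE conjE)
    have "B a \<inter> B b = {}" if ab: "a \<in> n ` {1..N}" "b \<in> n ` {1..N}" "a \<noteq> b" for a b
    proof -
      obtain i j where "i \<in> {1..N}" "j \<in> {1..N}" "a = n i" "b = n j" using ab by blast
      then show ?thesis using n(3) ab(3) by metis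
    qed
    then show ?R
      using n by (intro exI[of _ "n ` {1..N}"]) (auto simp: disjoint_family_on_def)
  next
    assume ?R
    then obtain T where T: "finite T" "T \<subseteq> {g..}" "\<forall>i\<in>T. B i \<subseteq> \<Omega>" "disjoint_family_on B T"
      "C * measure \<mu> \<Omega> \<le> measure \<mu> (\<Union>i\<in>T. B i)" by (elim exE conjE)
    define xs where "xs = sorted_list_of_set T"
    have xs: "set xs = T" "sorted xs" "distinct xs" using T(1) by (auto simp: xs_def)
    define n where "n i = xs ! (i - 1)" for i :: nat
    let ?N = "length xs"
    have nT: "n ` {1..?N} = T"
    proof -
      have "n ` {1..?N} = n ` (Suc ` {..<?N})"
        by (simp only: image_Suc_lessThan)
      also have "\<dots> = (\<lambda>i. xs ! i) ` {..<?N}" by (simp add: image_image n_def)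
      also have "\<dots> = T" using xs(1) by (auto simp: set_conv_nth)
      finally show ?thesis .
    qed
    have inj: "n i \<noteq> n j" if "i \<in> {1..?N}" "j \<in> {1..?N}" "i \<noteq> j" for i j
      using that xs(3) by (auto simp: n_def nth_eq_iff_index_eq)
    have inT: "n i \<in> T" if "i \<in> {1..?N}" for i using nT that by blast
    show ?L
    proof (intro exI[of _ ?N] exI[of _ n] conjI ballI impI)
      fix i j assume i: "i \<in> {1..?N}" and j: "j \<in> {1..?N}"
      show "n i \<le> n j" if "i \<le> j"
        unfolding n_def using that i j xs(2) by (intro sorted_nth_mono) auto
      show "B (n i) \<inter> B (n j) = {}" if "i \<noteq> j"
        using T(4) inT[OF i] inT[OF j] inj[OF i j that] by (auto simp: disjoint_family_on_def)
    next
      have "(\<Union>i\<in>{1..?N}. B (n i)) = (\<Union>i\<in>T. B i)" unfolding nT[symmetric] by simp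
      then show "C * measure \<mu> \<Omega> \<le> measure \<mu> (\<Union>i\<in>{1..?N}. B (n i))" using T(5) by simp
    qed (use T inT in auto)
  qed
  then show ?thesis unfolding asymptotically_covering_def by simp
qed

text \<open>Concatenate disjoint finite families \<open>F 0, F 1, ...\<close>, each of total measure at least
  \<open>C0 * measure \<mu> U\<close> and each beginning after the previous one ends. Since families are internally
  disjoint, the pairwise intersections of members of two of them have total measure at most
  \<open>measure \<mu> U\<close>; so after \<open>K\<close> families the double sum is at most \<open>K\<^sup>2 * measure \<mu> U\<close>, while the simple
  sum is at least \<open>K * C0 * measure \<mu> U\<close>.\<close>

lemma quasi_independent_subsequence:
  fixes B :: "nat \<Rightarrow> 'a set"
  assumes "finite_measure \<mu>" and B: "\<And>n. B n \<in> sets \<mu>" and U: "U \<in> sets \<mu>"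
    and pos: "measure \<mu> U > 0" "C0 > 0" and C: "C \<ge> 4 / C0\<^sup>2"
    and families: "\<And>g. \<exists>T. finite T \<and> T \<subseteq> {g..} \<and> (\<forall>i\<in>T. B i \<subseteq> U) \<and>
        disjoint_family_on B T \<and> C0 * measure \<mu> U \<le> measure \<mu> (\<Union>i\<in>T. B i)"
  shows "\<exists>\<phi> :: nat \<Rightarrow> nat. strict_mono \<phi> \<and> (\<forall>n. B (\<phi> n) \<subseteq> U) \<and>
    (\<Sum>n. emeasure \<mu> (B (\<phi> n))) = \<infinity> \<and>
    infinite {Q. (\<Sum>s=1..Q. \<Sum>t=1..Q. measure \<mu> (B (\<phi> s) \<inter> B (\<phi> t)))
      \<le> C / measure \<mu> U * (\<Sum>n=1..Q. measure \<mu> (B (\<phi> n)))\<^sup>2}"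
proof -
  interpret finite_measure \<mu> by fact
  define m where "m = measure \<mu> U"
  have m: "m > 0" using pos by (simp add: m_def)
  obtain T where T: "\<And>g. finite (T g)" "\<And>g. T g \<subseteq> {g..}" "\<And>g i. i \<in> T g \<Longrightarrow> B i \<subseteq> U"
      "\<And>g. disjoint_family_on B (T g)" "\<And>g. C0 * m \<le> measure \<mu> (\<Union>i\<in>T g. B i)"
    using families unfolding m_def by metis
  have T_ne: "T g \<noteq> {}" for g
    using T(5)[of g] mult_pos_pos[OF pos(2) m] by auto
  \<comment> \<open>\<open>G k\<close> is the index from which the family number \<open>k\<close> is chosen.\<close>
  define G where "G = rec_nat 0 (\<lambda>_ g. Suc (Max (T g)))"
  have G0: "G 0 = 0" and GSuc: "G (Suc k) = Suc (Max (T (G k)))" for k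
    by (simp_all add: G_def)
  define F where "F k = T (G k)" for k
  have F: "F k \<subseteq> {G k..<G (Suc k)}" for k
  proof
    fix i assume i: "i \<in> F k"
    then have "i \<le> Max (T (G k))" unfolding F_def by (intro Max_ge T(1))
    then show "i \<in> {G k..<G (Suc k)}" using T(2)[of "G k"] i by (auto simp: F_def GSuc)
  qed
  have GS: "G k < G (Suc k)" for k using F[of k] T_ne[of "G k"] by (fastforce simp: F_def)
  have Gmono: "strict_mono G" by (rule strict_monoI_Suc) (rule GS)
  have finF: "finite (F k)" for k by (simp add: F_def T(1))
  define I where "I = (\<Union>k. F k)"
  have I_less: "I \<inter> {..<G K} = (\<Union>k<K. F k)" for K
  proof -
    have "k < K" if "i \<in> F k" "i < G K" for i k
    proof -
      have "G k < G K" using F[of k] that by fastforce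
      then show ?thesis using Gmono by (simp add: strict_mono_less)
    qed
    moreover have "i < G K" if "i \<in> F k" "k < K" for i k
    proof -
      have "i < G (Suc k)" using F[of k] that by auto
      also have "\<dots> \<le> G K" using Gmono that by (simp add: strict_mono_less_eq)
      finally show ?thesis .
    qed
    ultimately show ?thesis unfolding I_def by blast
  qed
  have F_disj: "F k \<inter> F l = {}" if "k \<noteq> l" for k l
  proof -
    have *: "F k \<inter> F l = {}" if "k < l" for k l
    proof -
      have "G (Suc k) \<le> G l" using that Gmono by (simp add: strict_mono_less_eq)
      then show ?thesis using F[of k] F[of l] by fastforce
    qed
    show ?thesis using that *[of k l] *[of l k] by (cases "k < l") auto
  qed
  have infI: "infinite I"
  proof
    assume "finite I"
    then obtain n where n: "I \<subseteq> {..<n}" by (auto dest: finite_nat_bounded)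
    have "F n \<subseteq> I" by (auto simp: I_def)
    moreover have "n \<le> G n" using Gmono by (rule strict_mono_imp_increasing)
    moreover obtain i where "i \<in> F n" using T_ne[of "G n"] by (auto simp: F_def)
    ultimately show False using n F[of n] by fastforce
  qed
  define \<phi> where "\<phi> = enumerate I"
  have \<phi>: "strict_mono \<phi>" "range \<phi> = I"
    unfolding \<phi>_def using infI by (auto simp: strict_mono_enumerate range_enumerate)
  have BU: "B (\<phi> n) \<subseteq> U" for n
  proof -
    have "\<phi> n \<in> I" using \<phi>(2) by blast
    then show ?thesis using T(3) by (auto simp: I_def F_def)
  qed
  \<comment> \<open>The first indices of the subsequence, up to a suitable cut, run exactly through the first
    blocks.\<close>
  have cut: "\<exists>q. bij_betw \<phi> {..<q} (\<Union>k<K. F k)" for K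
  proof -
    define q where "q = (LEAST s. G K \<le> \<phi> s)"
    have "G K \<le> \<phi> (G K)" using \<phi>(1) by (rule strict_mono_imp_increasing)
    then have q: "G K \<le> \<phi> q" unfolding q_def by (rule LeastI)
    have "\<phi> s < G K \<longleftrightarrow> s < q" for s
    proof
      show "\<phi> s < G K" if "s < q" using not_less_Least[OF that[unfolded q_def]] by simp
      show "s < q" if "\<phi> s < G K"
      proof -
        have "\<phi> s < \<phi> q" using that q by simp
        then show ?thesis using \<phi>(1) by (simp add: strict_mono_less)
      qed
    qed
    then have "\<phi> ` {..<q} = I \<inter> {..<G K}" using \<phi>(2) by auto
    moreover have "inj_on \<phi> {..<q}"
      using \<phi>(1) strict_mono_imp_inj_on inj_on_subset by blast
    ultimately show ?thesis unfolding I_less bij_betw_def by blast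
  qed
  define V where "V k = (\<Union>i\<in>F k. B i)" for k
  have V: "V k \<in> sets \<mu>" for k unfolding V_def using finF B by auto
  have VU: "V k \<subseteq> U" for k unfolding V_def F_def using T(3) by blast
  have disjF: "disjoint_family_on B (F k)" for k unfolding F_def by (rule T(4))
  have blocks: "(\<Sum>n\<in>(\<Union>k<K. F k). f n) = (\<Sum>k<K. \<Sum>n\<in>F k. f n)" for K and f :: "nat \<Rightarrow> real"
    using finF F_disj by (intro sum.UNION_disjoint) auto
  have sum_block: "(\<Sum>n\<in>F k. measure \<mu> (B n)) = measure \<mu> (V k)" for k
    unfolding V_def using finF disjF B by (intro finite_measure_finite_Union[symmetric]) auto
  have sum_block2: "(\<Sum>s\<in>F k. \<Sum>t\<in>F l. measure \<mu> (B s \<inter> B t)) = measure \<mu> (V k \<inter> V l)" for k l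
  proof -
    have "(\<Sum>t\<in>F l. measure \<mu> (B s \<inter> B t)) = measure \<mu> (B s \<inter> V l)" for s
    proof -
      have "(\<Sum>t\<in>F l. measure \<mu> (B s \<inter> B t)) = measure \<mu> (\<Union>t\<in>F l. B s \<inter> B t)"
        using finF disjF[of l] B
        by (intro finite_measure_finite_Union[symmetric]) (auto simp: disjoint_family_on_def)
      then show ?thesis by (simp add: V_def)
    qed
    moreover have "(\<Sum>s\<in>F k. measure \<mu> (B s \<inter> V l)) = measure \<mu> (\<Union>s\<in>F k. B s \<inter> V l)"
      using finF disjF[of k] B V
      by (intro finite_measure_finite_Union[symmetric]) (auto simp: disjoint_family_on_def)
    ultimately show ?thesis by (simp add: V_def)
  qed
  have lower: "real K * (C0 * m) \<le> (\<Sum>n\<in>(\<Union>k<K. F k). measure \<mu> (B n))" for K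
  proof -
    have "(\<Sum>k<K. C0 * m) \<le> (\<Sum>k<K. measure \<mu> (V k))"
      using T(5) by (intro sum_mono) (simp add: V_def F_def)
    then show ?thesis by (simp add: blocks sum_block)
  qed
  have upper: "(\<Sum>s\<in>(\<Union>k<K. F k). \<Sum>t\<in>(\<Union>k<K. F k). measure \<mu> (B s \<inter> B t)) \<le> (real K)\<^sup>2 * m" for K
  proof -
    have swap: "(\<Sum>s\<in>F k. \<Sum>l<K. \<Sum>t\<in>F l. measure \<mu> (B s \<inter> B t)) =
        (\<Sum>l<K. \<Sum>s\<in>F k. \<Sum>t\<in>F l. measure \<mu> (B s \<inter> B t))" for k
      by (rule sum.swap)
    have "(\<Sum>s\<in>(\<Union>k<K. F k). \<Sum>t\<in>(\<Union>k<K. F k). measure \<mu> (B s \<inter> B t)) =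
        (\<Sum>k<K. \<Sum>l<K. measure \<mu> (V k \<inter> V l))"
      unfolding blocks swap sum_block2 ..
    also have "\<dots> \<le> (\<Sum>k<K. \<Sum>l<K. m)"
      unfolding m_def using VU U by (intro sum_mono finite_measure_mono) auto
    finally show ?thesis by (simp add: power2_eq_square)
  qed
  have diverges: "(\<Sum>n. emeasure \<mu> (B (\<phi> n))) = \<infinity>"
  proof (rule ccontr)
    assume "(\<Sum>n. emeasure \<mu> (B (\<phi> n))) \<noteq> \<infinity>"
    then have sm: "summable (\<lambda>n. measure \<mu> (B (\<phi> n)))"
      by (intro summable_suminf_not_top) (auto simp: emeasure_eq_measure)
    have "real K * (C0 * m) \<le> (\<Sum>n. measure \<mu> (B (\<phi> n)))" for K
    proof -
      obtain q where q: "bij_betw \<phi> {..<q} (\<Union>k<K. F k)" using cut by blast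
      have "real K * (C0 * m) \<le> (\<Sum>n<q. measure \<mu> (B (\<phi> n)))"
        using lower[of K] sum.reindex_bij_betw[OF q, of "\<lambda>n. measure \<mu> (B n)"] by simp
      also have "\<dots> \<le> (\<Sum>n. measure \<mu> (B (\<phi> n)))"
        using sm by (intro sum_le_suminf) auto
      finally show ?thesis .
    qed
    moreover obtain K where "(\<Sum>n. measure \<mu> (B (\<phi> n))) < real K * (C0 * m)"
      using reals_Archimedean3[of "C0 * m"] pos(2) m by auto
    ultimately show False by (meson not_less)
  qed
  have "\<exists>Q\<ge>N. (\<Sum>s=1..Q. \<Sum>t=1..Q. measure \<mu> (B (\<phi> s) \<inter> B (\<phi> t)))
      \<le> C / m * (\<Sum>n=1..Q. measure \<mu> (B (\<phi> n)))\<^sup>2" for N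
  proof -
    obtain K0 :: nat where K0: "2 / C0 \<le> real K0" using real_arch_simple by blast
    define K where "K = max K0 (Suc (\<phi> N))"
    obtain q where q: "bij_betw \<phi> {..<q} (\<Union>k<K. F k)" using cut by blast
    have "\<phi> N < K" by (simp add: K_def)
    also have "K \<le> G K" using Gmono by (rule strict_mono_imp_increasing)
    finally have "\<phi> N \<in> I \<inter> {..<G K}" using \<phi>(2) by auto
    then have "\<phi> N \<in> \<phi> ` {..<q}" using q unfolding I_less bij_betw_def by simp
    then have "N < q" using strict_mono_imp_inj_on[OF \<phi>(1)] by (auto simp: inj_on_def)
    then obtain Q where Q: "q = Suc Q" "N \<le> Q" by (cases q) auto
    define b where "b n = measure \<mu> (B (\<phi> n))" for n
    have range: "{..<q} = insert 0 {1..Q}" using Q by auto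
    have "(\<Sum>s=1..Q. \<Sum>t=1..Q. measure \<mu> (B (\<phi> s) \<inter> B (\<phi> t))) \<le>
        (\<Sum>s<q. \<Sum>t<q. measure \<mu> (B (\<phi> s) \<inter> B (\<phi> t)))"
    proof -
      have "(\<Sum>s=1..Q. \<Sum>t=1..Q. measure \<mu> (B (\<phi> s) \<inter> B (\<phi> t))) \<le>
          (\<Sum>s=1..Q. \<Sum>t<q. measure \<mu> (B (\<phi> s) \<inter> B (\<phi> t)))"
        unfolding range by (intro sum_mono sum_mono2) auto
      also have "\<dots> \<le> (\<Sum>s<q. \<Sum>t<q. measure \<mu> (B (\<phi> s) \<inter> B (\<phi> t)))"
        using range by (intro sum_mono2 sum_nonneg) auto
      finally show ?thesis .
    qed
    also have "\<dots> = (\<Sum>s<q. \<Sum>t\<in>(\<Union>k<K. F k). measure \<mu> (B (\<phi> s) \<inter> B t))"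
      by (intro sum.cong[OF refl]) (rule sum.reindex_bij_betw[OF q, where g = "\<lambda>t. measure \<mu> (B _ \<inter> B t)"])
    also have "\<dots> = (\<Sum>s\<in>(\<Union>k<K. F k). \<Sum>t\<in>(\<Union>k<K. F k). measure \<mu> (B s \<inter> B t))"
      by (rule sum.reindex_bij_betw[OF q,
            where g = "\<lambda>s. \<Sum>t\<in>(\<Union>k<K. F k). measure \<mu> (B s \<inter> B t)"])
    also have "\<dots> \<le> (real K)\<^sup>2 * m" by (rule upper)
    finally have up: "(\<Sum>s=1..Q. \<Sum>t=1..Q. measure \<mu> (B (\<phi> s) \<inter> B (\<phi> t))) \<le> (real K)\<^sup>2 * m" .
    have "real K * (C0 * m) \<le> (\<Sum>n<q. b n)"
      using lower[of K] sum.reindex_bij_betw[OF q, of "\<lambda>n. measure \<mu> (B n)"] by (simp add: b_def)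
    also have "\<dots> = b 0 + (\<Sum>n=1..Q. b n)" unfolding range by simp
    also have "b 0 \<le> m" unfolding b_def m_def using BU U by (intro finite_measure_mono) auto
    finally have "real K * (C0 * m) - m \<le> (\<Sum>n=1..Q. b n)" by simp
    \<comment> \<open>The sum starts at index 1; the omitted set of index 0 costs at most half of the bound.\<close>
    moreover have "m \<le> real K * (C0 * m) / 2"
    proof -
      have "2 / C0 \<le> real K" using K0 by (simp add: K_def)
      then have "2 \<le> real K * C0" using pos(2) by (simp add: field_simps)
      then have "2 * m \<le> real K * C0 * m" using m by (intro mult_right_mono) auto
      then show ?thesis by simp
    qed
    ultimately have "real K * (C0 * m) / 2 \<le> (\<Sum>n=1..Q. b n)" by linarith
    then have "(real K * (C0 * m) / 2)\<^sup>2 \<le> (\<Sum>n=1..Q. b n)\<^sup>2"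
      using pos m by (intro power_mono) auto
    moreover have "0 \<le> C / m"
    proof -
      have "0 \<le> 4 / C0\<^sup>2" by simp
      then have "0 \<le> C" using C by linarith
      then show ?thesis using m by simp
    qed
    ultimately have "C / m * (real K * (C0 * m) / 2)\<^sup>2 \<le> C / m * (\<Sum>n=1..Q. b n)\<^sup>2"
      by (rule mult_left_mono)
    moreover have "(real K)\<^sup>2 * m \<le> C / m * (real K * (C0 * m) / 2)\<^sup>2"
    proof -
      have "4 \<le> C * C0\<^sup>2" using C pos(2) by (simp add: pos_divide_le_eq)
      then have "4 * ((real K)\<^sup>2 * m / 4) \<le> C * C0\<^sup>2 * ((real K)\<^sup>2 * m / 4)"
        using m by (intro mult_right_mono) auto
      also have "\<dots> = C / m * (real K * (C0 * m) / 2)\<^sup>2"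
        using m by (simp add: power2_eq_square field_simps)
      finally show ?thesis by simp
    qed
    ultimately show ?thesis using up Q(2) unfolding b_def by (intro exI[of _ Q]) linarith
  qed
  then have "infinite {Q. (\<Sum>s=1..Q. \<Sum>t=1..Q. measure \<mu> (B (\<phi> s) \<inter> B (\<phi> t)))
      \<le> C / m * (\<Sum>n=1..Q. measure \<mu> (B (\<phi> n)))\<^sup>2}"
    unfolding infinite_nat_iff_unbounded_le by blast
  then show ?thesis using \<phi>(1) BU diverges unfolding m_def by blast
qed

text \<open>Almost every point of an open set \<open>\<Omega>\<close> lies in a cube of arbitrarily late index whose enlargement is
  contained in \<open>\<Omega>\<close>. Finitely many of these cubes fill half of \<open>\<Omega>\<close>, and the finite covering theorem applies to them.\<close>

lemma asymptotically_covering_enlarged: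
  fixes x :: "nat \<Rightarrow> real ^ 'n"
  assumes "prob_space \<mu>" and sets: "sets \<mu> = sets borel"
    and r: "\<And>n. r n > 0" "r \<longlonglongrightarrow> 0" and \<kappa>: "\<kappa> > 1"
    and full: "measure \<mu> (\<Inter>g. \<Union>n\<in>{g..}. sup_cball (x n) (r n)) = 1"
  shows "asymptotically_covering \<mu> (\<lambda>n. sup_cball (x n) (\<kappa> * r n))"
proof -
  interpret prob_space \<mu> by fact
  have space: "space \<mu> = UNIV" using sets_eq_imp_space_eq[OF sets] by simp
  let ?B = "\<lambda>n. sup_cball (x n) (r n)"
  let ?H = "\<lambda>n. sup_cball (x n) (\<kappa> * r n)"
  let ?E = "\<Inter>g. \<Union>n\<in>{g..}. ?B n"
  have B: "?B n \<in> sets \<mu>" for n using closed_sup_cball borel_closed sets by blast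
  have E: "?E \<in> sets \<mu>" using B by (intro sets.countable_INT) auto
  obtain M :: nat where M: "\<And>(x :: nat \<Rightarrow> real ^ 'n) r F \<mu>.
    (\<And>i. r i > 0) \<Longrightarrow> finite F \<Longrightarrow> finite_measure \<mu> \<Longrightarrow> sets \<mu> = sets borel \<Longrightarrow>
    \<exists>T\<subseteq>F. disjoint_family_on (\<lambda>i. sup_cball (x i) (\<kappa> * r i)) T \<and>
      measure \<mu> (\<Union>i\<in>F. sup_cball (x i) (r i))
        \<le> real (Suc M) * measure \<mu> (\<Union>i\<in>T. sup_cball (x i) (\<kappa> * r i))"
    by (rule disjoint_enlarged_subfamily[OF \<kappa>]) (erule that)
  have "\<exists>T. finite T \<and> T \<subseteq> {g..} \<and> (\<forall>i\<in>T. ?H i \<subseteq> \<Omega>) \<and> disjoint_family_on ?H T \<and>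
      1 / (2 * real (Suc M)) * measure \<mu> \<Omega> \<le> measure \<mu> (\<Union>i\<in>T. ?H i)"
    if \<Omega>: "open \<Omega>" for \<Omega> g
  proof (cases "measure \<mu> \<Omega> = 0")
    case True
    then show ?thesis by (intro exI[of _ "{}"]) (auto simp: disjoint_family_on_def)
  next
    case False
    then have pos: "measure \<mu> \<Omega> > 0" by (simp add: zero_less_measure_iff)
    have \<Omega>m: "\<Omega> \<in> sets \<mu>" using \<Omega> sets by simp
    define G where "G = {n. g \<le> n \<and> ?H n \<subseteq> \<Omega>}"
    have sub: "?E \<inter> \<Omega> \<subseteq> (\<Union>n\<in>G. ?B n)"
    proof
      fix y assume y: "y \<in> ?E \<inter> \<Omega>"
      then have y\<Omega>: "y \<in> \<Omega>" and yE: "\<exists>n\<in>{g'..}. y \<in> ?B n" for g' by (rule IntD2) (use y in fast)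
      obtain e where e: "e > 0" "ball y e \<subseteq> \<Omega>"
        using \<Omega>[unfolded open_contains_ball, THEN bspec, OF y\<Omega>] by (elim exE conjE)
      define \<delta> where "\<delta> = e / sqrt (real CARD('n))"
      have \<delta>: "\<delta> > 0" using e by (simp add: \<delta>_def)
      have "\<forall>\<^sub>F n in sequentially. r n < \<delta> / (\<kappa> + 1)"
        using r(2) \<delta> \<kappa> by (intro order_tendstoD) auto
      then obtain n0 where n0: "\<And>n. n \<ge> n0 \<Longrightarrow> r n < \<delta> / (\<kappa> + 1)"
        by (auto simp: eventually_sequentially)
      obtain n where n: "n \<ge> max g n0" "y \<in> ?B n" using yE[of "max g n0"] by auto
      have "?H n \<subseteq> \<Omega>"
      proof
        fix z assume z: "z \<in> ?H n"
        have "infnorm (y - z) \<le> (\<kappa> + 1) * r n"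
          using z n(2) infnorm_diff_triangle[of y z "x n"]
          by (simp add: sup_cball_def infnorm_sub[of "x n" z] algebra_simps)
        also have "\<dots> < \<delta>" using n0[of n] n(1) \<kappa> by (simp add: field_simps)
        finally have "sqrt (real CARD('n)) * infnorm (y - z) < e"
          by (simp add: \<delta>_def field_simps)
        then have "dist y z < e" using norm_le_infnorm[of "y - z"] by (simp add: dist_norm)
        then have "z \<in> ball y e" by simp
        then show "z \<in> \<Omega>" using e(2) by blast
      qed
      then show "y \<in> (\<Union>n\<in>G. ?B n)" using n by (auto simp: G_def)
    qed
    define V where "V k = (\<Union>n\<in>{n\<in>G. n \<le> k}. ?B n)" for k
    have V: "V k \<in> sets \<mu>" for k unfolding V_def using B by (intro sets.countable_UN') auto
    have "(\<lambda>k. measure \<mu> (V k)) \<longlonglongrightarrow> measure \<mu> (\<Union>k. V k)"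
    proof (rule finite_Lim_measure_incseq)
      show "range V \<subseteq> sets \<mu>" using V by blast
      show "incseq V" unfolding incseq_def V_def by (intro allI impI UN_mono) auto
    qed
    moreover have "measure \<mu> \<Omega> / 2 < measure \<mu> (\<Union>k. V k)"
    proof -
      have "measure \<mu> (space \<mu> - ?E) = 0" using prob_compl[OF E] full by simp
      then have "measure \<mu> \<Omega> = measure \<mu> (\<Omega> - (space \<mu> - ?E))"
        using E \<Omega>m by (intro measure_Diff_null_set[symmetric])
          (auto simp: emeasure_eq_measure intro!: null_setsI)
      also have "\<Omega> - (space \<mu> - ?E) = ?E \<inter> \<Omega>" by (auto simp: space)
      also have "measure \<mu> (?E \<inter> \<Omega>) \<le> measure \<mu> (\<Union>k. V k)"
      proof (rule finite_measure_mono)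
        have "(\<Union>n\<in>G. ?B n) \<subseteq> (\<Union>k. V k)" unfolding V_def by auto
        with sub show "?E \<inter> \<Omega> \<subseteq> (\<Union>k. V k)" by (rule subset_trans)
        show "(\<Union>k. V k) \<in> sets \<mu>" using V by blast
      qed
      finally show ?thesis using pos by linarith
    qed
    ultimately have "\<forall>\<^sub>F k in sequentially. measure \<mu> \<Omega> / 2 < measure \<mu> (V k)"
      by (rule order_tendstoD)
    then obtain k where k: "measure \<mu> \<Omega> / 2 < measure \<mu> (V k)"
      by (auto simp: eventually_sequentially)
    have "finite {n\<in>G. n \<le> k}" by (rule finite_subset[of _ "{..k}"]) auto
    from M[of r "{n\<in>G. n \<le> k}" \<mu> x, OF r(1) this finite_measure_axioms sets] obtain T
      where T: "T \<subseteq> {n\<in>G. n \<le> k}" "disjoint_family_on ?H T"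
        "measure \<mu> (V k) \<le> real (Suc M) * measure \<mu> (\<Union>i\<in>T. ?H i)"
      unfolding V_def by (elim exE conjE)
    have "measure \<mu> \<Omega> / 2 \<le> real (Suc M) * measure \<mu> (\<Union>i\<in>T. ?H i)" using T(3) k by linarith
    then have "1 / (2 * real (Suc M)) * measure \<mu> \<Omega> \<le> measure \<mu> (\<Union>i\<in>T. ?H i)"
      by (simp add: field_simps)
    moreover have "finite T" using T(1) by (rule finite_subset) (rule finite_subset[of _ "{..k}"], auto)
    ultimately show ?thesis using T(1,2) by (intro exI[of _ T]) (auto simp: G_def)
  qed
  then show ?thesis
    unfolding asymptotically_covering_iff by (intro exI[of _ "1 / (2 * real (Suc M))"]) auto
qed

section \<open>Covering sequences and quasi-independence\<close>

theorem proposition2p2: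
  fixes x :: "nat \<Rightarrow> real ^ 'n" and r :: "nat \<Rightarrow> real"
    and B :: "nat \<Rightarrow> (real ^ 'n) set" and \<mu> :: "(real ^ 'n) measure"
  assumes radius_pos: "\<And>n. r n > 0"
    and B_eq: "\<And>n. B n = sup_cball (x n) (r n)"
    and diameter_lim: "(\<lambda>n. sup_diameter (B n)) \<longlonglongrightarrow> 0"
    and prob: "prob_space \<mu>"
    and borel_sets: "sets \<mu> = sets borel"
  shows
    "(asymptotically_covering \<mu> B \<longrightarrow>
       (\<exists>C>1. \<forall>c. \<forall>\<rho>>0. measure \<mu> (sup_ball c \<rho>) > 0 \<longrightarrow>
         (\<exists>\<phi> L. strict_mono (\<phi> :: nat \<Rightarrow> nat) \<and> L = B \<circ> \<phi> \<and>
           (\<forall>n. L n \<subseteq> sup_ball c \<rho>) \<and>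
           (\<Sum>n. emeasure \<mu> (L n)) = \<infinity> \<and>
           infinite {Q::nat. (\<Sum>s=1..Q. \<Sum>t=1..Q. measure \<mu> (L s \<inter> L t))
              \<le> C / measure \<mu> (sup_ball c \<rho>) * (\<Sum>n=1..Q. measure \<mu> (L n))\<^sup>2})))
     \<and>
     ((\<exists>C>1. \<forall>c. \<forall>\<rho>>0. measure \<mu> (sup_ball c \<rho>) > 0 \<longrightarrow>
         (\<exists>\<phi> L. strict_mono (\<phi> :: nat \<Rightarrow> nat) \<and> L = B \<circ> \<phi> \<and>
           (\<forall>n. L n \<subseteq> sup_ball c \<rho>) \<and>
           (\<Sum>n. emeasure \<mu> (L n)) = \<infinity> \<and>
           infinite {Q::nat. (\<Sum>s=1..Q. \<Sum>t=1..Q. measure \<mu> (L s \<inter> L t))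
              \<le> C / measure \<mu> (sup_ball c \<rho>) * (\<Sum>n=1..Q. measure \<mu> (L n))\<^sup>2})) \<longrightarrow>
       measure \<mu> (\<Inter>g. \<Union>n\<in>{g..}. B n) = 1 \<and>
       (\<forall>\<kappa>>1. asymptotically_covering \<mu> (\<lambda>n. sup_cball (x n) (\<kappa> * r n))))"
proof (intro conjI impI)
  interpret prob_space \<mu> by (rule prob)
  have Bm: "B n \<in> sets \<mu>" for n
    unfolding B_eq using closed_sup_cball borel_closed borel_sets by blast
  have ball: "sup_ball c \<rho> \<in> sets \<mu>" for c \<rho> using open_sup_ball[of c \<rho>] borel_sets by simp
  {
    assume "asymptotically_covering \<mu> B"
    then obtain C0 where C0: "C0 > 0"
      and fam: "\<And>\<Omega> g. open \<Omega> \<Longrightarrow> \<exists>T. finite T \<and> T \<subseteq> {g..} \<and> (\<forall>i\<in>T. B i \<subseteq> \<Omega>) \<and>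
        disjoint_family_on B T \<and> C0 * measure \<mu> \<Omega> \<le> measure \<mu> (\<Union>i\<in>T. B i)"
      unfolding asymptotically_covering_iff by auto
    define C where "C = 4 / C0\<^sup>2 + 2"
    have "0 \<le> 4 / C0\<^sup>2" by simp
    then have C: "C > 1" "C \<ge> 4 / C0\<^sup>2" unfolding C_def by linarith+
    show "\<exists>C>1. \<forall>c. \<forall>\<rho>>0. measure \<mu> (sup_ball c \<rho>) > 0 \<longrightarrow>
         (\<exists>\<phi> L. strict_mono (\<phi> :: nat \<Rightarrow> nat) \<and> L = B \<circ> \<phi> \<and>
           (\<forall>n. L n \<subseteq> sup_ball c \<rho>) \<and>
           (\<Sum>n. emeasure \<mu> (L n)) = \<infinity> \<and>
           infinite {Q::nat. (\<Sum>s=1..Q. \<Sum>t=1..Q. measure \<mu> (L s \<inter> L t))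
              \<le> C / measure \<mu> (sup_ball c \<rho>) * (\<Sum>n=1..Q. measure \<mu> (L n))\<^sup>2})"
    proof (intro exI[of _ C] conjI allI impI C(1))
      fix c \<rho> assume pos: "measure \<mu> (sup_ball c \<rho>) > 0"
      obtain \<phi> :: "nat \<Rightarrow> nat" where \<phi>: "strict_mono \<phi>" "\<forall>n. B (\<phi> n) \<subseteq> sup_ball c \<rho>"
          "(\<Sum>n. emeasure \<mu> (B (\<phi> n))) = \<infinity>"
          "infinite {Q. (\<Sum>s=1..Q. \<Sum>t=1..Q. measure \<mu> (B (\<phi> s) \<inter> B (\<phi> t)))
            \<le> C / measure \<mu> (sup_ball c \<rho>) * (\<Sum>n=1..Q. measure \<mu> (B (\<phi> n)))\<^sup>2}"
        using quasi_independent_subsequence[OF finite_measure_axioms Bm ball pos C0 C(2)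
            fam[OF open_sup_ball]] by (elim exE conjE)
      then show "\<exists>\<phi> L. strict_mono (\<phi> :: nat \<Rightarrow> nat) \<and> L = B \<circ> \<phi> \<and>
           (\<forall>n. L n \<subseteq> sup_ball c \<rho>) \<and>
           (\<Sum>n. emeasure \<mu> (L n)) = \<infinity> \<and>
           infinite {Q::nat. (\<Sum>s=1..Q. \<Sum>t=1..Q. measure \<mu> (L s \<inter> L t))
              \<le> C / measure \<mu> (sup_ball c \<rho>) * (\<Sum>n=1..Q. measure \<mu> (L n))\<^sup>2}"
        by (intro exI[of _ \<phi>] exI[of _ "B \<circ> \<phi>"]) (simp only: o_apply simp_thms)
    qed
  next
    assume "\<exists>C>1. \<forall>c. \<forall>\<rho>>0. measure \<mu> (sup_ball c \<rho>) > 0 \<longrightarrow>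
         (\<exists>\<phi> L. strict_mono (\<phi> :: nat \<Rightarrow> nat) \<and> L = B \<circ> \<phi> \<and>
           (\<forall>n. L n \<subseteq> sup_ball c \<rho>) \<and>
           (\<Sum>n. emeasure \<mu> (L n)) = \<infinity> \<and>
           infinite {Q::nat. (\<Sum>s=1..Q. \<Sum>t=1..Q. measure \<mu> (L s \<inter> L t))
              \<le> C / measure \<mu> (sup_ball c \<rho>) * (\<Sum>n=1..Q. measure \<mu> (L n))\<^sup>2})"
    then obtain C where C: "C > 1" and sub: "\<forall>c. \<forall>\<rho>>0. measure \<mu> (sup_ball c \<rho>) > 0 \<longrightarrow>
         (\<exists>\<phi> L. strict_mono (\<phi> :: nat \<Rightarrow> nat) \<and> L = B \<circ> \<phi> \<and>
           (\<forall>n. L n \<subseteq> sup_ball c \<rho>) \<and>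
           (\<Sum>n. emeasure \<mu> (L n)) = \<infinity> \<and>
           infinite {Q::nat. (\<Sum>s=1..Q. \<Sum>t=1..Q. measure \<mu> (L s \<inter> L t))
              \<le> C / measure \<mu> (sup_ball c \<rho>) * (\<Sum>n=1..Q. measure \<mu> (L n))\<^sup>2})"
      by (elim exE conjE)
    let ?E = "\<Inter>g. \<Union>n\<in>{g..}. B n"
    have Em: "?E \<in> sets \<mu>" using Bm by (intro sets.countable_INT) auto
    show full: "measure \<mu> ?E = 1"
    proof (rule full_measure_if_uniform_density[OF prob borel_sets _ C])
      show "?E \<in> sets borel" using Em borel_sets by simp
      fix c :: "real ^ 'n" and \<rho> :: real assume "\<rho> > 0"
      let ?m = "measure \<mu> (sup_ball c \<rho>)"
      show "?m / C \<le> measure \<mu> (sup_ball c \<rho> \<inter> ?E)"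
      proof (cases "?m = 0")
        case False
        then have m: "?m > 0" by (simp add: zero_less_measure_iff)
        obtain \<phi> L where L: "strict_mono (\<phi> :: nat \<Rightarrow> nat)" "L = B \<circ> \<phi>"
            "\<forall>n. L n \<subseteq> sup_ball c \<rho>" "(\<Sum>n. emeasure \<mu> (L n)) = \<infinity>"
            "infinite {Q::nat. (\<Sum>s=1..Q. \<Sum>t=1..Q. measure \<mu> (L s \<inter> L t))
              \<le> C / ?m * (\<Sum>n=1..Q. measure \<mu> (L n))\<^sup>2}"
          using sub[rule_format, OF \<open>\<rho> > 0\<close> m] by (elim exE conjE)
        have "L n \<in> sets \<mu>" for n using L(2) Bm by simp
        from kochen_stone[OF prob this L(4) _ L(5)]
        have "1 / (C / ?m) \<le> measure \<mu> (\<Inter>g. \<Union>n\<in>{g..}. L n)" using C m by simp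
        also have "\<dots> \<le> measure \<mu> (sup_ball c \<rho> \<inter> ?E)"
        proof (rule finite_measure_mono)
          show "sup_ball c \<rho> \<inter> ?E \<in> sets \<mu>" using ball Em by (rule sets.Int)
          have "y \<in> (\<Union>n\<in>{g..}. B n)" if y: "y \<in> (\<Inter>g. \<Union>n\<in>{g..}. L n)" for y g
          proof -
            obtain n where n: "n \<ge> g" "y \<in> L n" using y by blast
            have "g \<le> \<phi> n" using n(1) strict_mono_imp_increasing[OF L(1), of n] by linarith
            then show ?thesis using n(2) L(2) by auto
          qed
          then show "(\<Inter>g. \<Union>n\<in>{g..}. L n) \<subseteq> sup_ball c \<rho> \<inter> ?E" using L(3) by blast
        qed
        finally show ?thesis by simp
      qed simp
    qed
    have "(\<lambda>n. sup_diameter (B n) / 2) \<longlonglongrightarrow> 0 / 2" by (intro tendsto_divide diameter_lim) auto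
    then have r0: "r \<longlonglongrightarrow> 0"
      using radius_pos by (simp add: B_eq sup_diameter_sup_cball less_imp_le)
    show "\<forall>\<kappa>>1. asymptotically_covering \<mu> (\<lambda>n. sup_cball (x n) (\<kappa> * r n))"
      using asymptotically_covering_enlarged[OF prob borel_sets radius_pos r0] full
      unfolding B_eq by blast
  }
qed

end
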